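(* Let $(X_1,\dots,X_M)$ have density $f\in\mathrm{MMEam}$ of the form $f(x_1,\dots,x_M)=\sum_{\mathbf i\in\mathscr S}p_{\mathbf i}f_{i_1}(x_1)\cdots f_{i_M}(x_M)$, with $M\ge2$, and let $B$ be a strictly positive random variable independent of $(X_1,\dots,X_M)$ with distribution function $G$. Put $X_i^\dagger=X_i/B$, $S^\dagger=\sum_{i=1}^MX_i^\dagger$, and fix $j\in\{1,\dots,M\}$. For a square matrix $C$, $y\ge0$ and an integer $m$, write $\mathcal G_m(-Cy)=\int_0^\infty r^m e^{-(-Cy)r}\,dG(r)$. Then for $h\in\mathbb N_0$, $y\ge0$, if $\mathbb E[B^{-h}]<\infty$, $$\mathbb E[(S^\dagger)^h\mathbf 1\{S^\dagger>y\}]=\sum_{\mathbf i\in\mathscr S}p_{\mathbf i}\,\alpha_{\mathbf i}\Big(\sum_{\ell=0}^h(-T_{\mathbf i})^{-(h-\ell+1)}\mathcal G_{\ell-h}(-T_{\mathbf i}y)\frac{h!}{\ell!}y^\ell\Big)t_{\mathbf i};$$ and for $k\in\mathbb N_+$, $h\in\mathbb N_0$, $y\ge0$, if $\mathbb E[B^{-k-h}]<\infty$, $$\mathbb E[(X_j^\dagger)^k(S^\dagger)^h\mathbf 1\{S^\dagger>y\}]=\sum_{\mathbf i\in\mathscr S}p_{\mathbf i}\,k!\,\big(\alpha^{[k]}_{i_j},0\big)\Big\{\sum_{\ell=0}^h\big(-A^{\{k,\mathbf i,j\}}\big)^{-(h-\ell+1)}\mathcal G_{\ell-k-h}(-A^{\{k,\mathbf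 i,j\}}y)\frac{h!}{\ell!}y^\ell\Big\}\begin{pmatrix}0\\ t_{(\mathbf i,j)}\end{pmatrix},$$ where $A^{\{k,\mathbf i,j\}}=\begin{pmatrix}T^{[k,0]}_{i_j}& t^{[k]}_{i_j}\alpha_{(\mathbf i,j)}\\ 0&T_{(\mathbf i,j)}\end{pmatrix}$.
   Context: An ME density is a probability density on $[0,\infty)$ of the form $g(x)=\alpha e^{Tx}t$ ($\alpha$ real row vector, $T$ real square matrix, $t$ real column vector); triples are taken with all eigenvalues of $T$ having strictly negative real part. MMEam: fix $L,M\in\mathbb N_+$ and ME densities $f_1,\dots,f_L$ with triples $(\alpha_j,T_j,t_j)$. Let $\mathscr S=\{1,\dots,L\}^M$, $\mathbf i=(i_1,\dots,i_M)$, and real numbers $p_{\mathbf i}$ (possibly negative) with $\sum p_{\mathbf i}=1$; $f(x)=\sum_{\mathbf i}p_{\mathbf i}f_{i_1}(x_1)\cdots f_{i_M}(x_M)$ on $[0,\infty)^M$ is an MMEam density if $f\ge0$. Convolution triple: for a finite sequence of indices $(k_1,\dots,k_m)$ in $\{1,\dots,L\}$, define $\alpha=(\alpha_{k_1},0,\dots,0)$, $t=(0,\dots,0,t_{k_m}^\top)^\top$ and $T$ the $m\times m$ block upper bidiagonal matrix with diagonal blocks $T_{k_1},\dots,T_{k_m}$, blocks $t_{k_r}\alpha_{k_{r+1}}$ in position $(r,r+1)$, zeros elsewhere (an ME representation of $f_{k_1}*\cdots*f_{k_m}$). $(\alpha_{\mathbf i},T_{\mathbf i},t_{\mathbf i})$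 is this triple for $(i_1,\dots,i_M)$, and $(\alpha_{(\mathbf i,j)},T_{(\mathbf i,j)},t_{(\mathbf i,j)})$ is this triple for $(i_1,\dots,i_{j-1},i_{j+1},\dots,i_M)$. For a $p\times p$ matrix $T$, $T^{[k,\lambda]}$ is the $(k+1)\times(k+1)$ block matrix with $T-\lambda I$ on diagonal blocks, $I$ on blocks immediately above the diagonal, zeros elsewhere; $\alpha^{[k]}_m=(\alpha_m,0,\dots,0)$ and $t^{[k]}_m=(0,\dots,0,t_m^\top)^\top$ with $k+1$ blocks. Zero blocks have appropriate dimensions. *)

theory Defs
  imports "HOL-Probability.Probability" "Jordan_Normal_Form.Char_Poly"
begin

(* Matrices are Jordan_Normal_Form matrices (real mat), row vectors are 1 x p
   matrices, column vectors are p x 1 matrices. *)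

definition mexp :: "real mat \<Rightarrow> real mat" where
  "mexp A = Matrix.mat (dim_row A) (dim_col A)
     (\<lambda>(a,b). \<Sum>n. (A ^\<^sub>m n) $$ (a,b) / fact n)"

definition minv :: "real mat \<Rightarrow> real mat" where
  "minv A = (SOME B. B \<in> carrier_mat (dim_row A) (dim_row A) \<and>
                     A * B = 1\<^sub>m (dim_row A) \<and> B * A = 1\<^sub>m (dim_row A))"

definition msum :: "nat \<Rightarrow> nat \<Rightarrow> (nat \<Rightarrow> real mat) \<Rightarrow> nat set \<Rightarrow> real mat" where
  "msum r c F I = Matrix.mat r c (\<lambda>ij. \<Sum>l\<in>I. F l $$ ij)"

definition row_cat :: "real mat \<Rightarrow> real mat \<Rightarrow> real mat" where
  "row_cat A B = four_block_mat A B (0\<^sub>m 0 (dim_col A)) (0\<^sub>m 0 (dim_col B))"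

definition col_cat :: "real mat \<Rightarrow> real mat \<Rightarrow> real mat" where
  "col_cat A B = four_block_mat A (0\<^sub>m (dim_row A) 0) B (0\<^sub>m (dim_row B) 0)"

definition me_fun :: "real mat \<Rightarrow> real mat \<Rightarrow> real mat \<Rightarrow> real \<Rightarrow> real" where
  "me_fun \<alpha> T t x = (\<alpha> * mexp (x \<cdot>\<^sub>m T) * t) $$ (0,0)"

definition me_triple :: "real mat \<Rightarrow> real mat \<Rightarrow> real mat \<Rightarrow> bool" where
  "me_triple \<alpha> T t \<longleftrightarrow> (\<exists>p. \<alpha> \<in> carrier_mat 1 p \<and> T \<in> carrier_mat p p \<and> t \<in> carrier_mat p 1 \<and>
     (\<forall>z. eigenvalue (map_mat complex_of_real T) z \<longrightarrow> Re z < 0))"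

definition me_density :: "real mat \<Rightarrow> real mat \<Rightarrow> real mat \<Rightarrow> bool" where
  "me_density \<alpha> T t \<longleftrightarrow> me_triple \<alpha> T t \<and> (\<forall>x\<ge>0. me_fun \<alpha> T t x \<ge> 0) \<and>
     (\<integral>\<^sup>+x\<in>{0..}. ennreal (me_fun \<alpha> T t x) \<partial>lborel) = 1"

fun conv_triple :: "(nat \<Rightarrow> real mat) \<Rightarrow> (nat \<Rightarrow> real mat) \<Rightarrow> (nat \<Rightarrow> real mat) \<Rightarrow> nat list
      \<Rightarrow> real mat \<times> real mat \<times> real mat" where
  "conv_triple a T t [] = (0\<^sub>m 1 0, 0\<^sub>m 0 0, 0\<^sub>m 0 1)"
| "conv_triple a T t [k] = (a k, T k, t k)"
| "conv_triple a T t (k # k' # ks) =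
     (let (a', T', t') = conv_triple a T t (k' # ks) in
       (row_cat (a k) (0\<^sub>m 1 (dim_col a')),
        four_block_mat (T k) (t k * a') (0\<^sub>m (dim_row T') (dim_col (T k))) T',
        col_cat (0\<^sub>m (dim_row (t k)) 1) t'))"

abbreviation ct_alpha where "ct_alpha a T t ks \<equiv> fst (conv_triple a T t ks)"
abbreviation ct_T where "ct_T a T t ks \<equiv> fst (snd (conv_triple a T t ks))"
abbreviation ct_t where "ct_t a T t ks \<equiv> snd (snd (conv_triple a T t ks))"

definition drop_idx :: "nat list \<Rightarrow> nat \<Rightarrow> nat list" where
  "drop_idx is j = take (j - 1) is @ drop j is"

text \<open>T^{[k,\<lambda>]}: (k+1) x (k+1) block matrix, T - \<lambda>I on the diagonal, I on the
  superdiagonal.\<close>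
definition blockT :: "real mat \<Rightarrow> nat \<Rightarrow> real \<Rightarrow> real mat" where
  "blockT T k lam = (let p = dim_row T in Matrix.mat ((k+1)*p) ((k+1)*p)
     (\<lambda>(r,c). if r div p = c div p then T $$ (r mod p, c mod p) - (if r mod p = c mod p then lam else 0)
              else if c div p = r div p + 1 then (if r mod p = c mod p then 1 else 0)
              else 0))"

definition alpha_blk :: "real mat \<Rightarrow> nat \<Rightarrow> real mat" where
  "alpha_blk \<alpha> k = (let p = dim_col \<alpha> in
     Matrix.mat 1 ((k+1)*p) (\<lambda>(r,c). if c < p then \<alpha> $$ (0,c) else 0))"

definition t_blk :: "real mat \<Rightarrow> nat \<Rightarrow> real mat" where
  "t_blk t k = (let p = dim_row t in
     Matrix.mat ((k+1)*p) 1 (\<lambda>(r,c). if r \<ge> k*p then t $$ (r - k*p, 0) else 0))"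

definition Gcal :: "real measure \<Rightarrow> int \<Rightarrow> real mat \<Rightarrow> real mat" where
  "Gcal G m D = Matrix.mat (dim_row D) (dim_col D)
     (\<lambda>(a,b). \<integral>r. r powi m * (mexp (- (r \<cdot>\<^sub>m D))) $$ (a,b) \<partial>G)"

end

theory Submission
  imports Defs "Jordan_Normal_Form.Schur_Decomposition"
begin

text \<open>Every mixture component is handled separately. The function \<open>x \<mapsto> x ^ k * f x\<close> is, up to the factor \<open>k!\<close>,
  matrix-exponential with matrix \<open>blockT T k 0\<close>, because its block vector solves the corresponding
  linear system. A convolution of two matrix-exponential functions is matrix-exponential with the
  block triangular matrix, by the fundamental theorem of calculus applied to a product of two matrix
  exponentials. So \<open>E[X\<^sub>j ^ k; S \<in> ds]\<close> has a matrix-exponential density with matrix \<open>A\<close>, and its \<open>h\<close>-th moment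
  beyond \<open>y b\<close> is an explicit primitive, which vanishes at infinity since all eigenvalues of \<open>A\<close> lie
  in the left half plane. Independence turns the result into an integral over the law of \<open>B\<close>.\<close>

subsection \<open>The matrix exponential\<close>

text \<open>The obstacle is the sign of the weights \<open>p is\<close>: a signed sum cannot be
  handled by nonnegative integration term by term. Each single component is a product of nonnegative
  functions, so Tonelli and the convolutions are carried out there in \<open>ennreal\<close>, and
  the result becomes a Bochner integral. The signed sum is then taken by linearity. Only the total
  density is nonnegative, and that is what permits Tonelli in the scaling variable. Since addition
  is commutative, coordinate j may be convolved first. This is why the matrix of the theorem starts
  with the block of the j-th index, followed by the word without position j. For k = 0 and j = 1 it
  is the plain convolution triple, so the first formula is the case k = 0 of the second. Dividing by
  b turns the threshold y into y b and contributes the factor b^-(k+h). The primitive at y b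
  contains (y b)^l, whence the exponent l - k - h of the transform. The factor k! undoes the x^k /
  k! that the block matrix produces.\<close>

lemma mult_mat_index:
  "A \<in> carrier_mat r m \<Longrightarrow> B \<in> carrier_mat m c \<Longrightarrow> i < r \<Longrightarrow> j < c \<Longrightarrow>
   (A * B) $$ (i,j) = (\<Sum>k<m. A $$ (i,k) * B $$ (k,j))"
  by (auto simp: scalar_prod_def atLeast0LessThan intro!: sum.cong)

lemma smult_pow_mat:
  fixes A :: "real mat"
  assumes A: "A \<in> carrier_mat n n"
  shows "(s \<cdot>\<^sub>m A) ^\<^sub>m k = s ^ k \<cdot>\<^sub>m A ^\<^sub>m k"
proof (induction k)
  case 0
  show ?case using A by (intro eq_matI) auto
next
  case (Suc k)
  have "(s \<cdot>\<^sub>m A) ^\<^sub>m Suc k = (s ^ k \<cdot>\<^sub>m A ^\<^sub>m k) * (s \<cdot>\<^sub>m A)"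
    by (simp add: Suc)
  also have "\<dots> = s ^ k \<cdot>\<^sub>m (s \<cdot>\<^sub>m (A ^\<^sub>m k * A))"
    using A by (metis mult_smult_assoc_mat mult_smult_distrib pow_carrier_mat smult_carrier_mat)
  finally show ?case
    using A by (intro eq_matI) auto
qed

text \<open>\<open>K\<close> may be rectangular. With \<open>K = A\<close> this is commutation with
  powers; with \<open>K\<close> the inclusion of an invariant block it says that powers restrict to
  that block.\<close>

lemma pow_mat_intertwine:
  fixes A :: "real mat"
  assumes A: "A \<in> carrier_mat n n" and B: "B \<in> carrier_mat m m" and K: "K \<in> carrier_mat n m"
    and eq: "A * K = K * B"
  shows "A ^\<^sub>m k * K = K * B ^\<^sub>m k"
proof (induction k)
  case 0
  show ?case using A B K by simp
next
  case (Suc k)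
  have "A ^\<^sub>m Suc k * K = A ^\<^sub>m k * (A * K)"
    using A K by (simp add: assoc_mult_mat[of _ n n _ n _ m])
  also have "\<dots> = (A ^\<^sub>m k * K) * B"
    unfolding eq using A B K by (simp add: assoc_mult_mat[of _ n n _ m _ m])
  also have "\<dots> = K * B ^\<^sub>m Suc k"
    unfolding Suc using B K by (simp add: assoc_mult_mat[of _ n m _ m _ m])
  finally show ?case .
qed

lemma pow_mat_Suc_left:
  fixes A :: "real mat"
  assumes A: "A \<in> carrier_mat n n"
  shows "A ^\<^sub>m Suc k = A * A ^\<^sub>m k"
  using pow_mat_intertwine[OF A A A refl] by simp

lemma pow_mat_entry_bound:
  fixes A :: "real mat"
  assumes A: "A \<in> carrier_mat n n"
  obtains K where "0 \<le> K" "\<And>k i j. i < n \<Longrightarrow> j < n \<Longrightarrow> \<bar>(A ^\<^sub>m k) $$ (i,j)\<bar> \<le> K ^ k"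
proof
  \<comment> \<open>The sum of all absolute entries dominates every absolute row sum, so one more
    factor \<open>A\<close> costs at most one more factor \<open>?K\<close>.\<close>
  let ?K = "\<Sum>a<n. \<Sum>b<n. \<bar>A $$ (a,b)\<bar>"
  show K: "0 \<le> ?K" by (intro sum_nonneg) auto
  show "\<bar>(A ^\<^sub>m k) $$ (i,j)\<bar> \<le> ?K ^ k" if ij: "i < n" "j < n" for k i j
    using ij
  proof (induction k arbitrary: i j)
    case 0
    then show ?case using A by auto
  next
    case (Suc k)
    have "\<bar>(A ^\<^sub>m Suc k) $$ (i,j)\<bar> = \<bar>\<Sum>m<n. A $$ (i,m) * (A ^\<^sub>m k) $$ (m,j)\<bar>"
      unfolding pow_mat_Suc_left[OF A] using A Suc.prems by (subst mult_mat_index[of _ n n _ n]) auto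
    also have "\<dots> \<le> (\<Sum>m<n. \<bar>A $$ (i,m)\<bar> * ?K ^ k)"
      by (rule order_trans[OF sum_abs])
         (auto simp: abs_mult intro!: sum_mono mult_left_mono Suc.IH Suc.prems)
    also have "\<dots> \<le> ?K * ?K ^ k"
      unfolding sum_distrib_right[symmetric]
    proof (intro mult_right_mono)
      show "(\<Sum>m<n. \<bar>A $$ (i,m)\<bar>) \<le> ?K"
        using Suc.prems by (intro member_le_sum[of i "{..<n}" "\<lambda>a. \<Sum>m<n. \<bar>A $$ (a,m)\<bar>"]) (auto intro: sum_nonneg)
    qed (use K in auto)
    finally show ?case by simp
  qed
qed

lemma mexp_carrier [simp]: "A \<in> carrier_mat r c \<Longrightarrow> mexp A \<in> carrier_mat r c"
  by (auto simp: mexp_def)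

lemma mexp_dim [simp]: "dim_row (mexp A) = dim_row A" "dim_col (mexp A) = dim_col A"
  by (auto simp: mexp_def)

lemma mexp_smult_carrier [simp]: "A \<in> carrier_mat r c \<Longrightarrow> mexp (s \<cdot>\<^sub>m A) \<in> carrier_mat r c"
  by simp

lemma summable_mexp:
  fixes A :: "real mat"
  assumes A: "A \<in> carrier_mat n n" and ij: "i < n" "j < n"
  shows "summable (\<lambda>k. (A ^\<^sub>m k) $$ (i,j) / fact k * s ^ k)"
proof -
  obtain K where K: "0 \<le> K" "\<And>k i j. i < n \<Longrightarrow> j < n \<Longrightarrow> \<bar>(A ^\<^sub>m k) $$ (i,j)\<bar> \<le> K ^ k"
    using pow_mat_entry_bound[OF A] by blast
  have "summable (\<lambda>k. inverse (fact k) * (K * \<bar>s\<bar>) ^ k)"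
    by (rule summable_exp)
  then show ?thesis
  proof (rule summable_comparison_test'[where N = 0])
    show "norm ((A ^\<^sub>m k) $$ (i,j) / fact k * s ^ k) \<le> inverse (fact k) * (K * \<bar>s\<bar>) ^ k" for k
      using K(2)[OF ij, of k]
      by (auto simp: abs_mult power_abs power_mult_distrib divide_simps intro!: mult_right_mono)
  qed
qed

lemma mexp_smult_index:
  fixes A :: "real mat"
  assumes A: "A \<in> carrier_mat n n" and ij: "i < n" "j < n"
  shows "mexp (s \<cdot>\<^sub>m A) $$ (i,j) = (\<Sum>k. (A ^\<^sub>m k) $$ (i,j) / fact k * s ^ k)"
proof -
  have "((s \<cdot>\<^sub>m A) ^\<^sub>m k) $$ (i,j) = s ^ k * (A ^\<^sub>m k) $$ (i,j)" for k
    unfolding smult_pow_mat[OF A] using A ij pow_carrier_mat[OF A, of k] by auto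
  then show ?thesis
    using A ij by (auto simp: mexp_def mult_ac)
qed

lemma mexp_zero:
  assumes A: "A \<in> carrier_mat n n"
  shows "mexp (0 \<cdot>\<^sub>m A) = 1\<^sub>m n"
proof (rule eq_matI)
  fix i j assume ij: "i < dim_row (1\<^sub>m n :: real mat)" "j < dim_col (1\<^sub>m n :: real mat)"
  then have ij': "i < n" "j < n" by auto
  have "mexp (0 \<cdot>\<^sub>m A) $$ (i,j) = (A ^\<^sub>m 0) $$ (i,j) / fact 0"
    unfolding mexp_smult_index[OF A ij'] by (rule powser_zero)
  then show "mexp (0 \<cdot>\<^sub>m A) $$ (i,j) = 1\<^sub>m n $$ (i,j)" using A ij' by simp
qed (use A in \<open>auto simp: mexp_def\<close>)

text \<open>The relation passes from powers to the series term by term; matrix products are finite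
  sums, so they may be exchanged with the convergent series entrywise.\<close>

lemma mexp_intertwine:
  assumes A: "A \<in> carrier_mat n n" and B: "B \<in> carrier_mat m m" and K: "K \<in> carrier_mat n m"
    and eq: "A * K = K * B"
  shows "mexp (s \<cdot>\<^sub>m A) * K = K * mexp (s \<cdot>\<^sub>m B)"
proof (rule eq_matI)
  fix i j assume "i < dim_row (K * mexp (s \<cdot>\<^sub>m B))" "j < dim_col (K * mexp (s \<cdot>\<^sub>m B))"
  then have ij: "i < n" "j < m" using B K by (auto simp: mexp_def)
  have "(mexp (s \<cdot>\<^sub>m A) * K) $$ (i,j)
      = (\<Sum>a<n. (\<Sum>k. (A ^\<^sub>m k) $$ (i,a) / fact k * s ^ k) * K $$ (a,j))"
    using ij A K by (subst mult_mat_index[of _ n n _ m]) (auto simp: mexp_smult_index[of _ n])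
  also have "\<dots> = (\<Sum>a<n. \<Sum>k. ((A ^\<^sub>m k) $$ (i,a) / fact k * s ^ k) * K $$ (a,j))"
    using ij by (intro sum.cong refl suminf_mult2 summable_mexp[OF A]) auto
  also have "\<dots> = (\<Sum>k. \<Sum>a<n. ((A ^\<^sub>m k) $$ (i,a) / fact k * s ^ k) * K $$ (a,j))"
    using ij by (intro suminf_sum[symmetric] summable_mult2 summable_mexp[OF A]) auto
  also have "\<dots> = (\<Sum>k. (A ^\<^sub>m k * K) $$ (i,j) / fact k * s ^ k)"
    using ij A K by (intro suminf_cong, subst mult_mat_index[of _ n n _ m])
      (auto simp: sum_distrib_left sum_distrib_right sum_divide_distrib mult_ac)
  also have "\<dots> = (\<Sum>k. (K * B ^\<^sub>m k) $$ (i,j) / fact k * s ^ k)"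
    by (simp add: pow_mat_intertwine[OF assms])
  also have "\<dots> = (\<Sum>k. \<Sum>a<m. K $$ (i,a) * ((B ^\<^sub>m k) $$ (a,j) / fact k * s ^ k))"
    using ij B K by (intro suminf_cong, subst mult_mat_index[of _ n m _ m])
      (auto simp: sum_distrib_left sum_distrib_right sum_divide_distrib mult_ac)
  also have "\<dots> = (\<Sum>a<m. \<Sum>k. K $$ (i,a) * ((B ^\<^sub>m k) $$ (a,j) / fact k * s ^ k))"
    using ij by (intro suminf_sum summable_mult summable_mexp[OF B]) auto
  also have "\<dots> = (\<Sum>a<m. K $$ (i,a) * (\<Sum>k. (B ^\<^sub>m k) $$ (a,j) / fact k * s ^ k))"
    using ij by (intro sum.cong refl suminf_mult summable_mexp[OF B]) auto
  also have "\<dots> = (K * mexp (s \<cdot>\<^sub>m B)) $$ (i,j)"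
    using ij B K by (subst mult_mat_index[of _ n m _ m]) (auto simp: mexp_smult_index[of _ m])
  finally show "(mexp (s \<cdot>\<^sub>m A) * K) $$ (i,j) = (K * mexp (s \<cdot>\<^sub>m B)) $$ (i,j)" .
qed (use A B K in \<open>auto simp: mexp_def\<close>)

text \<open>Sizes are data of a matrix and not part of its type, so differentiation is entrywise,
  and the predicate also records that the whole curve keeps one fixed size. The product rule can
  then be applied without separate size obligations.\<close>

definition mat_deriv :: "nat \<Rightarrow> nat \<Rightarrow> (real \<Rightarrow> real mat) \<Rightarrow> real mat \<Rightarrow> real \<Rightarrow> bool" where
  "mat_deriv r c F D x \<longleftrightarrow> (\<forall>s. F s \<in> carrier_mat r c) \<and> D \<in> carrier_mat r c \<and>
     (\<forall>i<r. \<forall>j<c. ((\<lambda>s. F s $$ (i,j)) has_real_derivative D $$ (i,j)) (at x))"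

lemma mat_derivD:
  assumes "mat_deriv r c F D x"
  shows "F s \<in> carrier_mat r c" "D \<in> carrier_mat r c"
    "i < r \<Longrightarrow> j < c \<Longrightarrow> ((\<lambda>s. F s $$ (i,j)) has_real_derivative D $$ (i,j)) (at x)"
  using assms by (auto simp: mat_deriv_def)

lemma mat_deriv_mult:
  assumes F: "mat_deriv r m F F' x" and G: "mat_deriv m c G G' x"
  shows "mat_deriv r c (\<lambda>s. F s * G s) (F' * G x + F x * G') x"
  unfolding mat_deriv_def
proof (intro conjI allI impI)
  note f = mat_derivD[OF F] and g = mat_derivD[OF G]
  show "F s * G s \<in> carrier_mat r c" for s using f(1) g(1) by (rule mult_carrier_mat)
  show "F' * G x + F x * G' \<in> carrier_mat r c"
    using f(1,2) g(1,2) by (intro add_carrier_mat mult_carrier_mat)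
  fix i j assume ij: "i < r" "j < c"
  have "(F' * G x + F x * G') $$ (i,j) = (F' * G x) $$ (i,j) + (F x * G') $$ (i,j)"
    using f(1)[of x] g(2) ij by (intro index_add_mat) auto
  also have "\<dots> = (\<Sum>k<m. F' $$ (i,k) * G x $$ (k,j) + G' $$ (k,j) * F x $$ (i,k))"
    unfolding mult_mat_index[OF f(1) g(2) ij] mult_mat_index[OF f(2) g(1) ij]
    by (simp add: sum.distrib mult_ac)
  finally have eq: "(F' * G x + F x * G') $$ (i,j) = \<dots>" .
  show "((\<lambda>s. (F s * G s) $$ (i,j)) has_real_derivative (F' * G x + F x * G') $$ (i,j)) (at x)"
    unfolding eq mult_mat_index[OF f(1) g(1) ij]
    by (intro DERIV_sum DERIV_mult f(3) g(3) ij) auto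
qed

lemma mat_deriv_const: "A \<in> carrier_mat r c \<Longrightarrow> mat_deriv r c (\<lambda>_. A) (0\<^sub>m r c) x"
  by (auto simp: mat_deriv_def)

lemma mat_deriv_cmult:
  assumes F: "mat_deriv m c F F' x" and A: "A \<in> carrier_mat r m"
  shows "mat_deriv r c (\<lambda>s. A * F s) (A * F') x"
  using mat_deriv_mult[OF mat_deriv_const[OF A] F] mult_carrier_mat[OF A mat_derivD(2)[OF F]]
  by (simp add: left_mult_zero_mat[OF mat_derivD(1)[OF F]])

lemma mat_deriv_multc:
  assumes F: "mat_deriv r m F F' x" and A: "A \<in> carrier_mat m c"
  shows "mat_deriv r c (\<lambda>s. F s * A) (F' * A) x"
  using mat_deriv_mult[OF F mat_deriv_const[OF A]] mult_carrier_mat[OF mat_derivD(2)[OF F] A]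
  by (simp add: right_mult_zero_mat[OF mat_derivD(1)[OF F]])

text \<open>Serves the curves \<open>mexp ((x - s) \<cdot>\<^sub>m A)\<close>, which run backwards
  both in the uniqueness argument and in the convolution.\<close>

lemma mat_deriv_reverse:
  assumes F: "mat_deriv r c F F' (a - x)"
  shows "mat_deriv r c (\<lambda>s. F (a - s)) (- F') x"
  unfolding mat_deriv_def
proof (intro conjI allI impI)
  fix i j assume ij: "i < r" "j < c"
  have "((\<lambda>s. F (a - s) $$ (i,j)) has_real_derivative F' $$ (i,j) * (0 - 1)) (at x)"
    by (rule DERIV_chain'[where g = "\<lambda>s. F s $$ (i,j)"])
       (auto intro!: derivative_eq_intros mat_derivD(3)[OF F] ij)
  moreover have "(- F') $$ (i,j) = F' $$ (i,j) * (0 - 1)"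
    using mat_derivD(2)[OF F] ij by simp
  ultimately show "((\<lambda>s. F (a - s) $$ (i,j)) has_real_derivative (- F') $$ (i,j)) (at x)" by simp
qed (use mat_derivD(1,2)[OF F] in auto)

lemma mat_deriv_zero_const:
  assumes "\<And>x. mat_deriv r c F (0\<^sub>m r c) x"
  shows "F a = F b"
proof (rule eq_matI)
  fix i j assume "i < dim_row (F b)" "j < dim_col (F b)"
  then have ij: "i < r" "j < c" using mat_derivD(1)[OF assms, of b] by auto
  show "F a $$ (i,j) = F b $$ (i,j)"
    using mat_derivD(3)[OF assms ij] ij by (intro DERIV_isconst_all) auto
qed (use mat_derivD(1)[OF assms, of a] mat_derivD(1)[OF assms, of b] in auto)

lemma mat_deriv_mexp:
  assumes A: "A \<in> carrier_mat n n"
  shows "mat_deriv n n (\<lambda>s. mexp (s \<cdot>\<^sub>m A)) (A * mexp (x \<cdot>\<^sub>m A)) x"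
  unfolding mat_deriv_def
proof (intro conjI allI impI)
  fix i j assume ij: "i < n" "j < n"
  have "((\<lambda>s. mexp (s \<cdot>\<^sub>m A) $$ (i,j)) has_real_derivative
       (\<Sum>k. diffs (\<lambda>k. (A ^\<^sub>m k) $$ (i,j) / fact k) k * x ^ k)) (at x)"
    unfolding mexp_smult_index[OF A ij]
    by (rule termdiffs_strong_converges_everywhere) (rule summable_mexp[OF A ij])
  \<comment> \<open>Differentiating shifts the series by one: the factor k + 1 reduces the
    factorial, and the extra power of \<open>A\<close> is split off on the left.\<close>
  also have "(\<Sum>k. diffs (\<lambda>k. (A ^\<^sub>m k) $$ (i,j) / fact k) k * x ^ k)
       = (\<Sum>k. (A * A ^\<^sub>m k) $$ (i,j) / fact k * x ^ k)"
    by (simp add: diffs_def pow_mat_Suc_left[OF A] field_simps del: pow_mat.simps of_nat_Suc)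
  also have "\<dots> = (\<Sum>k. \<Sum>a<n. A $$ (i,a) * ((A ^\<^sub>m k) $$ (a,j) / fact k * x ^ k))"
    using ij A by (intro suminf_cong, subst mult_mat_index[of _ n n _ n])
      (auto simp: sum_distrib_left sum_distrib_right sum_divide_distrib mult_ac)
  also have "\<dots> = (\<Sum>a<n. \<Sum>k. A $$ (i,a) * ((A ^\<^sub>m k) $$ (a,j) / fact k * x ^ k))"
    using ij by (intro suminf_sum summable_mult summable_mexp[OF A]) auto
  also have "\<dots> = (\<Sum>a<n. A $$ (i,a) * (\<Sum>k. (A ^\<^sub>m k) $$ (a,j) / fact k * x ^ k))"
    using ij by (intro sum.cong refl suminf_mult summable_mexp[OF A]) auto
  also have "\<dots> = (A * mexp (x \<cdot>\<^sub>m A)) $$ (i,j)"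
    using ij A by (subst mult_mat_index[of _ n n _ n]) (auto simp: mexp_smult_index[of _ n])
  finally show "((\<lambda>s. mexp (s \<cdot>\<^sub>m A) $$ (i,j)) has_real_derivative (A * mexp (x \<cdot>\<^sub>m A)) $$ (i,j)) (at x)" .
qed (use A in auto)

lemma mexp_commute:
  assumes A: "A \<in> carrier_mat n n"
  shows "mexp (s \<cdot>\<^sub>m A) * A = A * mexp (s \<cdot>\<^sub>m A)"
  by (rule mexp_intertwine[OF A A A refl])

text \<open>The curve \<open>s \<mapsto> mexp ((x - s) A) * V s\<close> is constant, which gives uniqueness for \<open>V' = A V\<close>.\<close>
lemma linear_ode_unique:
  assumes A: "A \<in> carrier_mat n n" and V: "\<And>s. mat_deriv n c V (A * V s) s"
  shows "V x = mexp (x \<cdot>\<^sub>m A) * V 0"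
proof -
  have Vc: "V s \<in> carrier_mat n c" for s by (rule mat_derivD(1)[OF V])
  let ?E = "\<lambda>s. mexp ((x - s) \<cdot>\<^sub>m A)"
  have "mat_deriv n c (\<lambda>s. ?E s * V s) (0\<^sub>m n c) s" for s
  proof -
    have "mat_deriv n c (\<lambda>s. ?E s * V s) (- (A * ?E s) * V s + ?E s * (A * V s)) s"
      by (rule mat_deriv_mult[OF mat_deriv_reverse[where F = "\<lambda>s. mexp (s \<cdot>\<^sub>m A)", OF mat_deriv_mexp[OF A]] V])
    also have "- (A * ?E s) * V s + ?E s * (A * V s) = - (A * ?E s * V s) + A * ?E s * V s"
      using A Vc[of s] by (simp add: assoc_mult_mat[of _ n n _ n _ c, symmetric] mexp_commute[OF A])
    also have "\<dots> = 0\<^sub>m n c"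
      using A Vc[of s] by (intro uminus_l_inv_mat) auto
    finally show ?thesis .
  qed
  from mat_deriv_zero_const[OF this, of x 0] show ?thesis
    by (simp add: mexp_zero[OF A] left_mult_one_mat[OF Vc])
qed

subsection \<open>Decay of stable matrix exponentials\<close>

definition hurwitz :: "real mat \<Rightarrow> bool" where
  "hurwitz A \<longleftrightarrow> (\<forall>z. eigenvalue (map_mat complex_of_real A) z \<longrightarrow> Re z < 0)"

text \<open>Variation of constants: \<open>x \<mapsto> exp (-\<mu> x) f x\<close> has derivative \<open>exp (-\<mu> x) w x\<close>.\<close>
lemma scalar_ode_decay:
  fixes f w :: "real \<Rightarrow> complex"
  assumes f: "\<And>x. (f has_vector_derivative (\<mu> * f x + w x)) (at x)"
    and w: "\<And>x. 0 \<le> x \<Longrightarrow> norm (w x) \<le> C * exp (- \<epsilon> * x)"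
    and C: "0 \<le> C" and \<mu>: "Re \<mu> < - \<epsilon>"
  obtains K where "0 \<le> K" "\<And>x. 0 \<le> x \<Longrightarrow> norm (f x) \<le> K * exp (- \<epsilon> * x)"
proof
  \<comment> \<open>The gap between the rate of \<mu> and the target rate. After multiplication by
    exp (-\<mu> x) the forcing is bounded by C exp (\<delta> x), whose primitive
    \<open>?\<phi>\<close> accounts for the summand C / \<delta> of the constant.\<close>
  define \<delta> where "\<delta> = - Re \<mu> - \<epsilon>"
  have \<delta>: "\<delta> > 0" using \<mu> by (simp add: \<delta>_def)
  let ?K = "norm (f 0) + C / \<delta>"
  show "0 \<le> ?K" using C \<delta> by simp
  show "norm (f x) \<le> ?K * exp (- \<epsilon> * x)" if "0 \<le> x" for x
  proof (cases "x = 0")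
    case True
    then show ?thesis using C \<delta> by simp
  next
    case False
    with that have x: "0 < x" by simp
    define g where "g = (\<lambda>x. exp (- \<mu> * complex_of_real x) * f x)"
    have e: "((\<lambda>x. exp (- \<mu> * complex_of_real x)) has_vector_derivative
        (- \<mu> * exp (- \<mu> * complex_of_real x))) (at x)" for x
    proof -
      have "((\<lambda>z. exp (- \<mu> * z)) has_field_derivative (- \<mu> * exp (- \<mu> * complex_of_real x)))
          (at (complex_of_real x))"
        by (auto intro!: derivative_eq_intros)
      from has_vector_derivative_real_field[OF this] show ?thesis by simp
    qed
    have g': "(g has_vector_derivative exp (- \<mu> * complex_of_real x) * w x) (at x)" for x
      unfolding g_def
      by (rule has_vector_derivative_eq_rhs[OF has_vector_derivative_mult[OF e f]])
         (simp add: algebra_simps)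
    let ?\<phi> = "\<lambda>x. C / \<delta> * exp (\<delta> * x)"
    have "norm (g x - g 0) \<le> ?\<phi> x - ?\<phi> 0"
    proof (rule differentiable_bound_general[OF x])
      show "continuous_on {0..x} g"
        by (intro continuous_at_imp_continuous_on ballI has_vector_derivative_continuous[OF g'])
      show "continuous_on {0..x} ?\<phi>" by (intro continuous_intros)
      show "(g has_vector_derivative exp (- \<mu> * complex_of_real y) * w y) (at y)" for y by (rule g')
      show "(?\<phi> has_vector_derivative (C * exp (\<delta> * y))) (at y)" for y
        unfolding has_real_derivative_iff_has_vector_derivative[symmetric]
        using \<delta> by (auto intro!: derivative_eq_intros)
      show "norm (exp (- \<mu> * complex_of_real y) * w y) \<le> C * exp (\<delta> * y)" if "0 < y" for y
      proof -
        have "norm (exp (- \<mu> * complex_of_real y) * w y) \<le> exp (- Re \<mu> * y) * (C * exp (- \<epsilon> * y))"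
          unfolding norm_mult using that by (intro mult_mono w) auto
        also have "\<dots> = C * exp (\<delta> * y)"
          by (simp add: \<delta>_def exp_add[symmetric] algebra_simps)
        finally show ?thesis .
      qed
    qed
    then have "norm (g x) \<le> norm (f 0) + C / \<delta> * exp (\<delta> * x)"
      using norm_triangle_sub[of "g x" "g 0"] divide_nonneg_pos[OF C \<delta>] by (simp add: g_def)
    also have "\<dots> \<le> ?K * exp (\<delta> * x)"
      using x \<delta> mult_left_mono[of 1 "exp (\<delta> * x)" "norm (f 0)"] by (simp add: algebra_simps)
    finally have g: "norm (g x) \<le> ?K * exp (\<delta> * x)" .
    have "norm (f x) = exp (Re \<mu> * x) * norm (g x)"
      by (simp add: g_def norm_mult exp_add[symmetric] mult.assoc[symmetric])
    also have "\<dots> \<le> exp (Re \<mu> * x) * (?K * exp (\<delta> * x))"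
      by (intro mult_left_mono g) auto
    also have "\<dots> = ?K * exp (Re \<mu> * x + \<delta> * x)"
      by (simp add: exp_add)
    also have "Re \<mu> * x + \<delta> * x = - \<epsilon> * x"
      by (simp add: \<delta>_def algebra_simps)
    finally show ?thesis .
  qed
qed

text \<open>Over the complex numbers the characteristic polynomial splits, and the Schur form has
  precisely the listed roots on its diagonal.\<close>

lemma complex_mat_triangularization:
  fixes A :: "complex mat"
  assumes A: "A \<in> carrier_mat n n"
  obtains B P Q where "similar_mat_wit A B P Q" "upper_triangular B"
    "\<And>i. i < n \<Longrightarrow> eigenvalue A (B $$ (i,i))"
proof -
  obtain es where es: "char_poly A = (\<Prod>e\<leftarrow>es. [:- e, 1:])"
    using char_poly_factorized[OF A] by auto
  obtain B P Q where B: "schur_decomposition A es = (B, P, Q)"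
    by (cases "schur_decomposition A es")
  have s: "similar_mat_wit A B P Q" "upper_triangular B" "diag_mat B = es"
    using schur_decomposition[OF A es B] by auto
  have Bc: "B \<in> carrier_mat n n" using similar_mat_witD2[OF A s(1)] by auto
  show ?thesis
  proof (rule that[OF s(1,2)])
    fix i assume i: "i < n"
    then have "B $$ (i,i) \<in> set es"
      unfolding s(3)[symmetric] diag_mat_def using Bc by auto
    then show "eigenvalue A (B $$ (i,i))"
      unfolding eigenvalue_root_char_poly[OF A] es
      by (auto simp: poly_prod_list prod_list_zero_iff image_iff intro!: bexI)
  qed
qed

text \<open>After triangularization the rows of \<open>Q * E x\<close> satisfy scalar equations,
  each forced only by the rows below it. Solving from the last row upwards gives exponential decay
  without any description of Jordan blocks.\<close>

lemma mexp_decay: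
  assumes A: "A \<in> carrier_mat n n" and h: "hurwitz A"
  obtains C \<epsilon> where "0 < \<epsilon>" "0 \<le> C"
    "\<And>x i j. 0 \<le> x \<Longrightarrow> i < n \<Longrightarrow> j < n \<Longrightarrow> \<bar>mexp (x \<cdot>\<^sub>m A) $$ (i,j)\<bar> \<le> C * exp (- \<epsilon> * x)"
proof -
  let ?A = "map_mat complex_of_real A"
  have Ac: "?A \<in> carrier_mat n n" using A by simp
  obtain B P Q where B: "similar_mat_wit ?A B P Q" "upper_triangular B"
    "\<And>i. i < n \<Longrightarrow> eigenvalue ?A (B $$ (i,i))"
    by (rule complex_mat_triangularization[OF Ac]) blast
  note w = similar_mat_witD2[OF Ac B(1)]
  \<comment> \<open>Halving makes \<epsilon> strictly smaller than every decay rate, as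
    \<open>scalar_ode_decay\<close> demands, so the same \<epsilon> survives all rows. The element 1
    keeps the set nonempty for n = 0.\<close>
  let ?D = "insert 1 ((\<lambda>i. - Re (B $$ (i,i)) / 2) ` {..<n})"
  define \<epsilon> where "\<epsilon> = Min ?D"
  have neg: "Re (B $$ (i,i)) < 0" if "i < n" for i
    using B(3)[OF that] h by (auto simp: hurwitz_def)
  have \<epsilon>: "0 < \<epsilon>" unfolding \<epsilon>_def using neg by (subst Min_gr_iff) auto
  have \<epsilon>i: "Re (B $$ (i,i)) < - \<epsilon>" if "i < n" for i
  proof -
    have "\<epsilon> \<le> - Re (B $$ (i,i)) / 2" unfolding \<epsilon>_def using that by (intro Min_le) auto
    with neg[OF that] show ?thesis by linarith
  qed
  define E where "E = (\<lambda>x. map_mat complex_of_real (mexp (x \<cdot>\<^sub>m A)))"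
  have E: "E x \<in> carrier_mat n n" for x using A by (simp add: E_def)
  \<comment> \<open>Since A = P B Q and Q P = 1, the curve Q exp (x A) has derivative B Q exp (x A);
    row i sees only rows m \<ge> i.\<close>
  define f where "f = (\<lambda>i j x. (Q * E x) $$ (i,j))"
  have f': "(f i j has_vector_derivative
      (B $$ (i,i) * f i j x + (\<Sum>m\<in>{i<..<n}. B $$ (i,m) * f m j x))) (at x)"
    if ij: "i < n" "j < n" for i j x
  proof -
    have "((\<lambda>x. \<Sum>k<n. Q $$ (i,k) * E x $$ (k,j)) has_vector_derivative
        (\<Sum>k<n. Q $$ (i,k) * (?A * E x) $$ (k,j))) (at x)"
    proof (intro has_vector_derivative_sum has_vector_derivative_mult_right)
      fix k assume k: "k \<in> {..<n}"
      have "((\<lambda>x. complex_of_real (mexp (x \<cdot>\<^sub>m A) $$ (k,j))) has_vector_derivative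
          complex_of_real ((A * mexp (x \<cdot>\<^sub>m A)) $$ (k,j))) (at x)"
        using k ij mat_derivD(3)[OF mat_deriv_mexp[OF A], of k j x]
        by (intro has_vector_derivative_of_real)
           (auto simp: has_real_derivative_iff_has_vector_derivative)
      moreover have "complex_of_real ((A * mexp (x \<cdot>\<^sub>m A)) $$ (k,j)) = (?A * E x) $$ (k,j)"
        using k ij A E[of x] by (subst (1 2) mult_mat_index[of _ n n _ n]) (auto simp: E_def)
      moreover have "complex_of_real (mexp (x \<cdot>\<^sub>m A) $$ (k,j)) = E x $$ (k,j)" for x
        using k ij A by (simp add: E_def)
      ultimately show "((\<lambda>x. E x $$ (k,j)) has_vector_derivative (?A * E x) $$ (k,j)) (at x)" by simp
    qed
    also have "(\<lambda>x. \<Sum>k<n. Q $$ (i,k) * E x $$ (k,j)) = f i j"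
      using ij w(7) E by (auto simp: f_def fun_eq_iff mult_mat_index[of _ n n _ n])
    also have "(\<Sum>k<n. Q $$ (i,k) * (?A * E x) $$ (k,j)) = (Q * (?A * E x)) $$ (i,j)"
      using ij w(7) E Ac by (subst mult_mat_index[of _ n n _ n]) auto
    also have "Q * (?A * E x) = B * (Q * E x)"
    proof -
      have "Q * ?A = Q * (P * (B * Q))"
        unfolding w(3) by (simp add: assoc_mult_mat[OF w(6,5,7)])
      also have "\<dots> = (Q * P) * (B * Q)"
        by (rule assoc_mult_mat[symmetric, OF w(7,6) mult_carrier_mat[OF w(5,7)]])
      also have "\<dots> = B * Q"
        unfolding w(2) by (rule left_mult_one_mat[OF mult_carrier_mat[OF w(5,7)]])
      finally show ?thesis
        using assoc_mult_mat[OF w(7) Ac E[of x]] assoc_mult_mat[OF w(5,7) E[of x]] by metis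
    qed
    also have "(B * (Q * E x)) $$ (i,j) = (\<Sum>m<n. B $$ (i,m) * f m j x)"
      using ij w(5,7) E by (subst mult_mat_index[of _ n n _ n]) (auto simp: f_def)
    also have "\<dots> = (\<Sum>m\<in>insert i {i<..<n}. B $$ (i,m) * f m j x)"
      using ij upper_triangularD[OF B(2), of _ i] w(5) by (intro sum.mono_neutral_right) auto
    also have "\<dots> = B $$ (i,i) * f i j x + (\<Sum>m\<in>{i<..<n}. B $$ (i,m) * f m j x)"
      by simp
    finally show ?thesis .
  qed
  have "\<exists>C\<ge>0. \<forall>x\<ge>0. norm (f i j x) \<le> C * exp (- \<epsilon> * x)" if i: "i < n" and j: "j < n" for i j
    using i
  \<comment> \<open>The measure decreases as i grows, so the bounds for all later rows are available
    as bounds on the forcing.\<close>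
  proof (induction "n - i" arbitrary: i rule: less_induct)
    case less
    have "\<forall>m. \<exists>C. m \<in> {i<..<n} \<longrightarrow> C \<ge> 0 \<and> (\<forall>x\<ge>0. norm (f m j x) \<le> C * exp (- \<epsilon> * x))"
    proof (intro allI)
      fix m
      show "\<exists>C. m \<in> {i<..<n} \<longrightarrow> C \<ge> 0 \<and> (\<forall>x\<ge>0. norm (f m j x) \<le> C * exp (- \<epsilon> * x))"
        using less(1)[of m] by (cases "m \<in> {i<..<n}") auto
    qed
    from choice[OF this] obtain c where c: "\<And>m. m \<in> {i<..<n} \<Longrightarrow> c m \<ge> 0"
      "\<And>m x. m \<in> {i<..<n} \<Longrightarrow> 0 \<le> x \<Longrightarrow> norm (f m j x) \<le> c m * exp (- \<epsilon> * x)"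
      by blast
    obtain K where "0 \<le> K" "\<And>x. 0 \<le> x \<Longrightarrow> norm (f i j x) \<le> K * exp (- \<epsilon> * x)"
    proof (rule scalar_ode_decay[OF f'[OF less.prems j]])
      show "norm (\<Sum>m\<in>{i<..<n}. B $$ (i,m) * f m j x)
          \<le> (\<Sum>m\<in>{i<..<n}. norm (B $$ (i,m)) * c m) * exp (- \<epsilon> * x)" if "0 \<le> x" for x
        unfolding sum_distrib_right
        using c that by (intro sum_norm_le) (auto simp: norm_mult mult.assoc intro!: mult_left_mono)
    qed (use c(1) \<epsilon>i[OF less.prems] in \<open>auto intro!: sum_nonneg\<close>)
    then show ?case by blast
  qed
  then obtain c where c: "\<And>i j. i < n \<Longrightarrow> j < n \<Longrightarrow> c i j \<ge> 0"
    "\<And>i j x. i < n \<Longrightarrow> j < n \<Longrightarrow> 0 \<le> x \<Longrightarrow> norm (f i j x) \<le> c i j * exp (- \<epsilon> * x)"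
    by metis
  \<comment> \<open>Multiplication by \<open>P\<close> undoes the change of basis and only changes
    the constant; the real entries are bounded through their complex copies.\<close>
  define K where "K = (\<lambda>i j. \<Sum>k<n. norm (P $$ (i,k)) * c k j)"
  have K0: "K i j \<ge> 0" if "j < n" for i j
    using that c(1) by (auto simp: K_def intro!: sum_nonneg)
  have K: "\<bar>mexp (x \<cdot>\<^sub>m A) $$ (i,j)\<bar> \<le> K i j * exp (- \<epsilon> * x)" if "0 \<le> x" "i < n" "j < n" for x i j
  proof -
    have "P * (Q * E x) = E x"
      using assoc_mult_mat[OF w(6,7) E[of x]] left_mult_one_mat[OF E[of x]] by (simp add: w(1))
    then have "E x $$ (i,j) = (P * (Q * E x)) $$ (i,j)" by simp
    also have "\<dots> = (\<Sum>k<n. P $$ (i,k) * f k j x)"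
      using that w(6,7) E by (subst mult_mat_index[of _ n n _ n]) (auto simp: f_def)
    also have "norm \<dots> \<le> K i j * exp (- \<epsilon> * x)"
      unfolding K_def sum_distrib_right
      using c that by (intro sum_norm_le) (auto simp: norm_mult mult.assoc intro!: mult_left_mono)
    finally show ?thesis
      using that A by (simp add: E_def)
  qed
  show ?thesis
  proof (rule that[OF \<epsilon>, of "\<Sum>i<n. \<Sum>j<n. K i j"])
    show "0 \<le> (\<Sum>i<n. \<Sum>j<n. K i j)" using K0 by (auto intro!: sum_nonneg)
    fix x :: real and i j assume x: "0 \<le> x" and ij: "i < n" "j < n"
    have "K i j \<le> (\<Sum>j<n. K i j)"
      using ij K0 by (intro member_le_sum[of j "{..<n}" "K i"]) auto
    also have "\<dots> \<le> (\<Sum>i<n. \<Sum>j<n. K i j)"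
      using ij K0 by (intro member_le_sum[of i "{..<n}" "\<lambda>i. \<Sum>j<n. K i j"]) (auto intro!: sum_nonneg)
    finally have "K i j * exp (- \<epsilon> * x) \<le> (\<Sum>i<n. \<Sum>j<n. K i j) * exp (- \<epsilon> * x)"
      by (intro mult_right_mono) auto
    with K[OF x ij] show "\<bar>mexp (x \<cdot>\<^sub>m A) $$ (i,j)\<bar> \<le> (\<Sum>i<n. \<Sum>j<n. K i j) * exp (- \<epsilon> * x)"
      by linarith
  qed
qed

text \<open>The characteristic polynomial of a block triangular matrix is the product of those of
  the diagonal blocks, so the eigenvalues are those of the two blocks together.\<close>

lemma hurwitz_four_block:
  assumes A: "A \<in> carrier_mat n n" and C: "C \<in> carrier_mat n m" and D: "D \<in> carrier_mat m m"
    and h: "hurwitz A" "hurwitz D"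
  shows "hurwitz (four_block_mat A C (0\<^sub>m m n) D)"
proof -
  let ?c = "map_mat complex_of_real"
  have c: "?c A \<in> carrier_mat n n" "?c C \<in> carrier_mat n m" "?c D \<in> carrier_mat m m"
    using A C D by auto
  have eq: "?c (four_block_mat A C (0\<^sub>m m n) D) = four_block_mat (?c A) (?c C) (0\<^sub>m m n) (?c D)"
    using A C D by (intro eq_matI) auto
  have cp: "char_poly (?c (four_block_mat A C (0\<^sub>m m n) D)) = char_poly (?c A) * char_poly (?c D)"
    unfolding eq using char_poly_factorized[OF c(1)] char_poly_factorized[OF c(3)]
    by (intro char_poly_0_block[OF refl _ _ c]) blast+
  have Fc: "?c (four_block_mat A C (0\<^sub>m m n) D) \<in> carrier_mat (n + m) (n + m)"
    using A D by simp
  show ?thesis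
    using h unfolding hurwitz_def eigenvalue_root_char_poly[OF Fc] cp
      eigenvalue_root_char_poly[OF c(1)] eigenvalue_root_char_poly[OF c(3)]
    by auto
qed

section \<open>The block matrix with identity superdiagonal and the inverse of a stable
  matrix\<close>

lemma blockT_carrier [simp]:
  "T \<in> carrier_mat p p \<Longrightarrow> blockT T k lam \<in> carrier_mat ((k+1) * p) ((k+1) * p)"
  by (auto simp: blockT_def Let_def)

lemma blockT_index:
  assumes "T \<in> carrier_mat p p" "q \<le> k" "q' \<le> k" "a < p" "b < p"
  shows "blockT T k lam $$ (q * p + a, q' * p + b) =
    (if q = q' then T $$ (a,b) - (if a = b then lam else 0)
     else if q' = Suc q \<and> a = b then 1 else 0)"
proof -
  have bound: "q * p + a < p + k * p" if "q \<le> k" "a < p" for q a :: nat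
    using that mult_le_mono1[of q k p] by linarith
  have r: "(q * p + a) div p = q" "(q * p + a) mod p = a" and c: "(q' * p + b) div p = q'" "(q' * p + b) mod p = b"
    using assms(4,5) by auto
  have d: "dim_row T = p" using assms(1) by simp
  have lt: "q * p + a < (k+1) * p" "q' * p + b < (k+1) * p"
    using bound[OF assms(2,4)] bound[OF assms(3,5)] by simp_all
  show ?thesis
    unfolding blockT_def Let_def d index_mat(1)[OF lt] prod.case r c by simp
qed

text \<open>Splits off the first block row. The coupling block is left existential because stability
  depends only on the diagonal blocks.\<close>

lemma blockT_Suc:
  assumes T: "T \<in> carrier_mat p p"
  obtains C where "C \<in> carrier_mat p ((k+1) * p)"
    "blockT T (Suc k) lam = four_block_mat (blockT T 0 lam) C (0\<^sub>m ((k+1) * p) p) (blockT T k lam)"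
proof
  let ?C = "Matrix.mat p ((k+1) * p) (\<lambda>(r,c). if r = c then 1 else 0 :: real)"
  show "?C \<in> carrier_mat p ((k+1) * p)" by simp
  show "blockT T (Suc k) lam = four_block_mat (blockT T 0 lam) ?C (0\<^sub>m ((k+1) * p) p) (blockT T k lam)"
    (is "_ = ?F")
  proof (rule eq_matI)
    show "dim_row (blockT T (Suc k) lam) = dim_row ?F" "dim_col (blockT T (Suc k) lam) = dim_col ?F"
      using T by (auto simp: blockT_def Let_def)
    fix i j assume "i < dim_row ?F" "j < dim_col ?F"
    then have ij: "i < p + (k+1) * p" "j < p + (k+1) * p" using T by (auto simp: blockT_def Let_def)
    then have p: "p > 0" by (cases p) auto
    have shift: "i div p = Suc ((i - p) div p) \<and> i mod p = (i - p) mod p" if "\<not> i < p" for i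
      using that p by (simp add: le_div_geq le_mod_geq)
    have "i < p \<Longrightarrow> i div p = 0 \<and> i mod p = i" for i by simp
    then show "blockT T (Suc k) lam $$ (i,j) = ?F $$ (i,j)"
      using T ij p shift[of i] shift[of j]
      by (auto simp: blockT_def Let_def div_eq_0_iff)
  qed
qed

lemma blockT_0: "T \<in> carrier_mat p p \<Longrightarrow> blockT T 0 0 = T"
  by (intro eq_matI) (auto simp: blockT_def Let_def)

lemma hurwitz_blockT:
  assumes T: "T \<in> carrier_mat p p" and h: "hurwitz T"
  shows "hurwitz (blockT T k 0)"
proof (induction k)
  case 0
  show ?case using h by (simp add: blockT_0[OF T])
next
  case (Suc k)
  obtain C where C: "C \<in> carrier_mat p ((k+1) * p)"
    "blockT T (Suc k) 0 = four_block_mat (blockT T 0 0) C (0\<^sub>m ((k+1) * p) p) (blockT T k 0)"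
    by (rule blockT_Suc[OF T])
  show ?case unfolding C(2) blockT_0[OF T]
    by (rule hurwitz_four_block[OF T C(1) blockT_carrier[OF T] h Suc])
qed

text \<open>A stable matrix cannot have eigenvalue 0, so its determinant is nonzero and the choice
  in \<open>minv\<close> is met by a true inverse. The product with \<open>A\<close>, with its minus
  sign, is the form needed to differentiate the tail primitive.\<close>

lemma minv_hurwitz:
  assumes A: "A \<in> carrier_mat n n" and h: "hurwitz A"
  shows "minv (- A) \<in> carrier_mat n n" "minv (- A) * A = - 1\<^sub>m n"
proof -
  have mA: "- A \<in> carrier_mat n n" using A by simp
  have "det A \<noteq> 0"
  proof
    assume "det A = 0"
    then have "det (map_mat complex_of_real A) = 0"
      by (simp add: of_real_hom.hom_det)
    moreover have "char_matrix (map_mat complex_of_real A) 0 = map_mat complex_of_real A"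
      using A by (intro eq_matI) (auto simp: char_matrix_def)
    ultimately have "eigenvalue (map_mat complex_of_real A) 0"
      using A by (subst eigenvalue_det[of _ n]) auto
    with h show False by (auto simp: hurwitz_def)
  qed
  then have "det (- A) \<noteq> 0" using det_0_negate[OF A] by simp
  then obtain B where B: "B \<in> carrier_mat n n" "- A * B = 1\<^sub>m n" "B * - A = 1\<^sub>m n"
    using det_non_zero_imp_unit[OF mA] A
    by (auto simp: Units_def ring_mat_def)
  have "\<exists>B. B \<in> carrier_mat n n \<and> - A * B = 1\<^sub>m n \<and> B * - A = 1\<^sub>m n"
    using B by blast
  from someI_ex[OF this]
  have N: "minv (- A) \<in> carrier_mat n n" "- A * minv (- A) = 1\<^sub>m n" "minv (- A) * - A = 1\<^sub>m n"
    using A by (simp_all add: minv_def del: uminus_mult_left_mat uminus_mult_right_mat)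
  show "minv (- A) \<in> carrier_mat n n" by (rule N(1))
  have "minv (- A) * A = - (minv (- A) * - A)"
    using N(1) A by simp
  then show "minv (- A) * A = - 1\<^sub>m n"
    by (simp add: N(3) del: uminus_mult_left_mat uminus_mult_right_mat)
qed

subsection \<open>Convolution\<close>

lemma row_cat_carrier [simp]:
  "a \<in> carrier_mat r p \<Longrightarrow> b \<in> carrier_mat r q \<Longrightarrow> row_cat a b \<in> carrier_mat r (p + q)"
  by (auto simp: row_cat_def)

lemma col_cat_carrier [simp]:
  "a \<in> carrier_mat p c \<Longrightarrow> b \<in> carrier_mat q c \<Longrightarrow> col_cat a b \<in> carrier_mat (p + q) c"
  by (auto simp: col_cat_def)

lemma sum_lessThan_add:
  fixes f :: "nat \<Rightarrow> 'a :: comm_monoid_add"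
  shows "(\<Sum>k<p + q. f k) = (\<Sum>k<p. f k) + (\<Sum>k<q. f (p + k))"
proof -
  have "{..<p + q} = {..<p} \<union> {p..<p + q}" by auto
  then have "(\<Sum>k<p + q. f k) = (\<Sum>k<p. f k) + (\<Sum>k=p..<p + q. f k)"
    by (simp add: sum.union_disjoint ivl_disj_int)
  also have "(\<Sum>k=p..<p + q. f k) = (\<Sum>k<q. f (p + k))"
    using sum.shift_bounds_nat_ivl[of f 0 p q] by (simp add: atLeast0LessThan add.commute)
  finally show ?thesis .
qed

lemma row_cat_mult_col_cat:
  assumes a: "a \<in> carrier_mat r p" and b: "b \<in> carrier_mat r q"
    and X: "X \<in> carrier_mat p c" and Y: "Y \<in> carrier_mat q c"
  shows "row_cat a b * col_cat X Y = a * X + b * Y"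
proof (rule eq_matI)
  fix i j assume "i < dim_row (a * X + b * Y)" "j < dim_col (a * X + b * Y)"
  then have ij: "i < r" "j < c" using b Y by auto
  have "(row_cat a b * col_cat X Y) $$ (i,j)
      = (\<Sum>k<p. a $$ (i,k) * X $$ (k,j)) + (\<Sum>k<q. b $$ (i,k) * Y $$ (k,j))"
    unfolding mult_mat_index[OF row_cat_carrier[OF a b] col_cat_carrier[OF X Y] ij] sum_lessThan_add
    using a b X Y ij by (intro arg_cong2[of _ _ _ _ "(+)"] sum.cong) (auto simp: row_cat_def col_cat_def)
  also have "\<dots> = (a * X + b * Y) $$ (i,j)"
    using a b X Y ij by (simp add: mult_mat_index[OF a X ij] mult_mat_index[OF b Y ij])
  finally show "(row_cat a b * col_cat X Y) $$ (i,j) = (a * X + b * Y) $$ (i,j)" .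
qed (use a b X Y in \<open>auto simp: row_cat_def col_cat_def\<close>)

lemma four_block_eq_col_cat:
  assumes "A \<in> carrier_mat r p" "B \<in> carrier_mat r q" "C \<in> carrier_mat s p" "D \<in> carrier_mat s q"
  shows "four_block_mat A B C D = col_cat (row_cat A B) (row_cat C D)"
  using assms by (intro eq_matI) (auto simp: row_cat_def col_cat_def)

lemma col_cat_mult:
  assumes X: "X \<in> carrier_mat p m" and Y: "Y \<in> carrier_mat q m" and Z: "Z \<in> carrier_mat m c"
  shows "col_cat X Y * Z = col_cat (X * Z) (Y * Z)"
proof (rule eq_matI)
  fix i j assume "i < dim_row (col_cat (X * Z) (Y * Z))" "j < dim_col (col_cat (X * Z) (Y * Z))"
  then have ij: "i < p + q" "j < c" using X Y Z by (auto simp: col_cat_def)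
  show "(col_cat X Y * Z) $$ (i,j) = col_cat (X * Z) (Y * Z) $$ (i,j)"
    unfolding mult_mat_index[OF col_cat_carrier[OF X Y] Z ij]
    using ij X Y Z by (auto simp: col_cat_def scalar_prod_def atLeast0LessThan intro!: sum.cong)
qed (use X Y Z in \<open>auto simp: col_cat_def\<close>)

lemma four_block_mult_col_cat:
  assumes A: "A \<in> carrier_mat r p" "B \<in> carrier_mat r q" "C \<in> carrier_mat s p" "D \<in> carrier_mat s q"
    and X: "X \<in> carrier_mat p c" and Y: "Y \<in> carrier_mat q c"
  shows "four_block_mat A B C D * col_cat X Y = col_cat (A * X + B * Y) (C * X + D * Y)"
  unfolding four_block_eq_col_cat[OF A]
  by (subst col_cat_mult[OF row_cat_carrier[OF A(1,2)] row_cat_carrier[OF A(3,4)] col_cat_carrier[OF X Y]])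
     (simp add: row_cat_mult_col_cat[OF A(1,2) X Y] row_cat_mult_col_cat[OF A(3,4) X Y])

section \<open>Scalar functions given by a matrix exponential\<close>

lemma bilinear_index:
  assumes a: "a \<in> carrier_mat 1 n" and X: "X \<in> carrier_mat n n" and t: "t \<in> carrier_mat n 1"
  shows "(a * X * t) $$ (0,0) = (\<Sum>i<n. \<Sum>j<n. a $$ (0,i) * X $$ (i,j) * t $$ (j,0))"
proof -
  have "(a * X * t) $$ (0,0) = (\<Sum>j<n. (\<Sum>i<n. a $$ (0,i) * X $$ (i,j)) * t $$ (j,0))"
    using a t by (subst mult_mat_index[OF mult_carrier_mat[OF a X] t])
      (auto simp: mult_mat_index[OF a X])
  also have "\<dots> = (\<Sum>j<n. \<Sum>i<n. a $$ (0,i) * X $$ (i,j) * t $$ (j,0))"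
    by (simp add: sum_distrib_right)
  finally show ?thesis by (subst sum.swap)
qed

lemma bilinear_mexp_decay:
  assumes a: "a \<in> carrier_mat 1 n" and A: "A \<in> carrier_mat n n" and t: "t \<in> carrier_mat n 1"
    and h: "hurwitz A"
  obtains C \<epsilon> where "0 < \<epsilon>" "0 \<le> C"
    "\<And>s. 0 \<le> s \<Longrightarrow> \<bar>(a * mexp (s \<cdot>\<^sub>m A) * t) $$ (0,0)\<bar> \<le> C * exp (- \<epsilon> * s)"
proof -
  obtain C \<epsilon> where e: "0 < \<epsilon>" "0 \<le> C"
    "\<And>x i j. 0 \<le> x \<Longrightarrow> i < n \<Longrightarrow> j < n \<Longrightarrow> \<bar>mexp (x \<cdot>\<^sub>m A) $$ (i,j)\<bar> \<le> C * exp (- \<epsilon> * x)"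
    by (rule mexp_decay[OF A h]) blast
  let ?K = "\<Sum>i<n. \<Sum>j<n. \<bar>a $$ (0,i)\<bar> * C * \<bar>t $$ (j,0)\<bar>"
  show ?thesis
  proof (rule that[OF e(1), of ?K])
    show "0 \<le> ?K" using e(2) by (auto intro!: sum_nonneg)
    fix s :: real assume s: "0 \<le> s"
    have "\<bar>(a * mexp (s \<cdot>\<^sub>m A) * t) $$ (0,0)\<bar>
        \<le> (\<Sum>i<n. \<Sum>j<n. \<bar>a $$ (0,i)\<bar> * (C * exp (- \<epsilon> * s)) * \<bar>t $$ (j,0)\<bar>)"
      unfolding bilinear_index[OF a mexp_smult_carrier[OF A] t]
      by (intro order_trans[OF sum_abs] sum_mono)
         (auto simp: abs_mult s intro!: mult_left_mono mult_right_mono e(3)[simplified])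
    also have "\<dots> = ?K * exp (- \<epsilon> * s)"
      by (simp add: sum_distrib_left sum_distrib_right mult_ac)
    finally show "\<bar>(a * mexp (s \<cdot>\<^sub>m A) * t) $$ (0,0)\<bar> \<le> ?K * exp (- \<epsilon> * s)" .
  qed
qed

text \<open>Unlike \<open>me_density\<close> it does not fix the total mass: after weighting with
  x^k / k! the mass is a moment and no longer 1. Stability and nonnegativity are the properties that
  survive both the weighting and the convolution.\<close>

definition me_rep :: "nat \<Rightarrow> real mat \<Rightarrow> real mat \<Rightarrow> real mat \<Rightarrow> bool" where
  "me_rep n \<alpha> T t \<longleftrightarrow> \<alpha> \<in> carrier_mat 1 n \<and> T \<in> carrier_mat n n \<and> t \<in> carrier_mat n 1 \<and> hurwitz T \<and>
     (\<forall>x\<ge>0. 0 \<le> me_fun \<alpha> T t x)"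

lemma me_repD:
  assumes "me_rep n \<alpha> T t"
  shows "\<alpha> \<in> carrier_mat 1 n" "T \<in> carrier_mat n n" "t \<in> carrier_mat n 1" "hurwitz T"
    "0 \<le> x \<Longrightarrow> 0 \<le> me_fun \<alpha> T t x"
  using assms by (auto simp: me_rep_def)

lemma me_density_me_rep:
  assumes "me_density \<alpha> T t"
  shows "me_rep (dim_row T) \<alpha> T t"
  using assms by (auto simp: me_density_def me_triple_def me_rep_def hurwitz_def)

lemma bilinear_mexp_deriv:
  assumes a: "a \<in> carrier_mat 1 n" and A: "A \<in> carrier_mat n n" and t: "t \<in> carrier_mat n 1"
  shows "((\<lambda>s. (a * mexp (s \<cdot>\<^sub>m A) * t) $$ (0,0)) has_real_derivative
      (a * (A * mexp (x \<cdot>\<^sub>m A)) * t) $$ (0,0)) (at x)"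
  by (rule mat_derivD(3)[OF mat_deriv_multc[OF mat_deriv_cmult[OF mat_deriv_mexp[OF A] a] t]]) auto

lemma me_fun_measurable [measurable]:
  assumes "me_rep n \<alpha> T t"
  shows "me_fun \<alpha> T t \<in> borel_measurable borel"
  unfolding me_fun_def
  by (intro borel_measurable_continuous_onI continuous_at_imp_continuous_on ballI
      DERIV_isCont[OF bilinear_mexp_deriv[OF me_repD(1-3)[OF assms]]])

text \<open>The cut at 0 is part of the function, so convolutions may be written over the whole line
  and their limits of integration come from the indicators.\<close>

definition me_dens :: "real mat \<Rightarrow> real mat \<Rightarrow> real mat \<Rightarrow> real \<Rightarrow> ennreal" where
  "me_dens \<alpha> T t x = ennreal (me_fun \<alpha> T t x) * indicator {0..} x"

lemma me_dens_measurable [measurable]: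
  assumes "me_rep n \<alpha> T t"
  shows "me_dens \<alpha> T t \<in> borel_measurable borel"
  unfolding me_dens_def using me_fun_measurable[OF assms] by measurable

text \<open>One step of the recursion for convolution triples, freed from words: the first factor
  may then also be a blocked triple, which is no entry of the given family.\<close>

definition conv_step :: "real mat \<times> real mat \<times> real mat \<Rightarrow> real mat \<times> real mat \<times> real mat
    \<Rightarrow> real mat \<times> real mat \<times> real mat" where
  "conv_step = (\<lambda>(a, S, b) (c, T, d). (row_cat a (0\<^sub>m 1 (dim_row T)),
     four_block_mat S (b * c) (0\<^sub>m (dim_row T) (dim_row S)) T, col_cat (0\<^sub>m (dim_row S) 1) d))"

text \<open>The convolution integrand is the derivative of
  \<open>(a, 0) * mexp (s A) * (0, mexp ((x - s) T) d)\<close>, \<open>A\<close> being the block matrix.\<close>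
lemma me_conv:
  assumes f: "me_rep p a S b" and g: "me_rep q c T d" and x: "0 \<le> x"
    and cs: "conv_step (a, S, b) (c, T, d) = (\<alpha>, A, \<tau>)"
  shows "(\<integral>\<^sup>+s. ennreal (me_fun a S b s * me_fun c T d (x - s)) * indicator {0..x} s \<partial>lborel)
       = ennreal (me_fun \<alpha> A \<tau> x)" (is ?int)
    and "0 \<le> me_fun \<alpha> A \<tau> x" (is ?nonneg)
proof -
  note F = me_repD[OF f] and G = me_repD[OF g]
  have cs': "\<alpha> = row_cat a (0\<^sub>m 1 q)" "A = four_block_mat S (b * c) (0\<^sub>m q p) T" "\<tau> = col_cat (0\<^sub>m p 1) d"
    using cs F(2) G(2) by (auto simp: conv_step_def)
  have bc: "b * c \<in> carrier_mat p q" using F(3) G(1) by (rule mult_carrier_mat)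
  have A: "A \<in> carrier_mat (p + q) (p + q)" and al: "\<alpha> \<in> carrier_mat 1 (p + q)"
    and ta: "\<tau> \<in> carrier_mat (p + q) 1"
    unfolding cs' using F(1-3) G(1-3) by auto
  \<comment> \<open>\<open>K\<close> and \<open>J\<close> are the inclusions of the two blocks. The
    first block is invariant (A K = K S), while A J = K b c + J T: mass leaving the second block
    enters the first only through the coupling b c.\<close>
  define K where "K = col_cat (1\<^sub>m p) (0\<^sub>m q p :: real mat)"
  define J where "J = col_cat (0\<^sub>m p q :: real mat) (1\<^sub>m q)"
  have K: "K \<in> carrier_mat (p + q) p" and J: "J \<in> carrier_mat (p + q) q"
    by (auto simp: K_def J_def)
  have AK: "A * K = K * S"
    unfolding cs' K_def
    by (subst four_block_mult_col_cat[OF F(2) bc zero_carrier_mat G(2) one_carrier_mat zero_carrier_mat],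
        subst col_cat_mult[OF one_carrier_mat zero_carrier_mat F(2)])
       (use F G bc in simp)
  have JX: "J * X = col_cat (0\<^sub>m p m) X" if "X \<in> carrier_mat q m" for X m
    unfolding J_def col_cat_mult[OF zero_carrier_mat one_carrier_mat that] using that by simp
  have KX: "K * X = col_cat X (0\<^sub>m q m)" if "X \<in> carrier_mat p m" for X m
    unfolding K_def col_cat_mult[OF one_carrier_mat zero_carrier_mat that] using that by simp
  have AJX: "A * (J * X) = K * (b * c * X) + J * (T * X)" if X: "X \<in> carrier_mat q m" for X m
  proof -
    have "A * (J * X) = col_cat (b * c * X) (T * X)"
      unfolding cs' JX[OF X] 
      by (subst four_block_mult_col_cat[OF F(2) bc zero_carrier_mat G(2) zero_carrier_mat X])
         (use F(2) mult_carrier_mat[OF bc X] mult_carrier_mat[OF G(2) X] in simp)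
    also have "\<dots> = col_cat (b * c * X) (0\<^sub>m q m) + col_cat (0\<^sub>m p m) (T * X)"
      using bc G(2) X by (intro eq_matI) (auto simp: col_cat_def)
    finally show ?thesis
      by (simp add: JX[OF mult_carrier_mat[OF G(2) X]] KX[OF mult_carrier_mat[OF bc X]])
  qed
  have alK: "\<alpha> * K = a"
    unfolding cs' K_def row_cat_mult_col_cat[OF F(1) zero_carrier_mat one_carrier_mat zero_carrier_mat]
    using F(1) by simp
  have alJX: "\<alpha> * (J * X) = 0\<^sub>m 1 m" if X: "X \<in> carrier_mat q m" for X m
    unfolding cs' JX[OF X] row_cat_mult_col_cat[OF F(1) zero_carrier_mat zero_carrier_mat X]
    using F(1) X by simp
  let ?E = "\<lambda>s. mexp (s \<cdot>\<^sub>m A)" and ?V = "\<lambda>s. mexp ((x - s) \<cdot>\<^sub>m T) * d"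
  have E: "?E s \<in> carrier_mat (p + q) (p + q)" and V: "?V s \<in> carrier_mat q 1" for s
    by (rule mexp_smult_carrier[OF A], rule mult_carrier_mat[OF mexp_smult_carrier[OF G(2)] G(3)])
  define H where "H = (\<lambda>s. (\<alpha> * (?E s * (J * ?V s))) $$ (0,0))"
  have H': "(H has_real_derivative me_fun a S b s * me_fun c T d (x - s)) (at s)" for s
  proof -
    let ?TV = "T * ?V s"
    have TV: "?TV \<in> carrier_mat q 1" using G(2) V by (rule mult_carrier_mat)
    have dV: "mat_deriv q 1 ?V (- ?TV) s"
    proof -
      have "mat_deriv q 1 ?V (- (T * mexp ((x - s) \<cdot>\<^sub>m T)) * d) s"
        by (rule mat_deriv_multc[OF mat_deriv_reverse[where F = "\<lambda>s. mexp (s \<cdot>\<^sub>m T)", OF mat_deriv_mexp[OF G(2)]] G(3)])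
      also have "- (T * mexp ((x - s) \<cdot>\<^sub>m T)) * d = - ?TV"
        using assoc_mult_mat[OF G(2) mexp_smult_carrier[OF G(2)] G(3), of "x - s"] G(2,3)
          uminus_mult_left_mat[of "T * mexp ((x - s) \<cdot>\<^sub>m T)" d] by simp
      finally show ?thesis .
    qed
    have "mat_deriv 1 1 (\<lambda>s. \<alpha> * (?E s * (J * ?V s)))
        (\<alpha> * (A * ?E s * (J * ?V s) + ?E s * (J * - ?TV))) s"
      by (intro mat_deriv_cmult[OF _ al] mat_deriv_mult[OF mat_deriv_mexp[OF A]] mat_deriv_cmult[OF dV J])
    \<comment> \<open>Moving \<open>A\<close> past the exponential and splitting A J as above, the
      two terms with J T cancel, and the coupling term alone remains.\<close>
    also have "A * ?E s * (J * ?V s) + ?E s * (J * - ?TV) = ?E s * (K * (b * c * ?V s))"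
    proof -
      have JV: "J * ?V s \<in> carrier_mat (p + q) 1" "J * ?TV \<in> carrier_mat (p + q) 1"
        "K * (b * c * ?V s) \<in> carrier_mat (p + q) 1"
        by (rule mult_carrier_mat[OF J V] mult_carrier_mat[OF J TV]
          mult_carrier_mat[OF K mult_carrier_mat[OF bc V]])+
      have "A * ?E s * (J * ?V s) = ?E s * (K * (b * c * ?V s) + J * ?TV)"
        unfolding mexp_commute[OF A, symmetric] assoc_mult_mat[OF E A JV(1)] AJX[OF V] ..
      also have "\<dots> = ?E s * (K * (b * c * ?V s)) + ?E s * (J * ?TV)"
        by (rule mult_add_distrib_mat[OF E JV(3,2)])
      finally have e1: "A * ?E s * (J * ?V s) = ?E s * (K * (b * c * ?V s)) + ?E s * (J * ?TV)" .
      have e2: "J * - ?TV = - (J * ?TV)"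
        by (rule uminus_mult_right_mat) (simp only: carrier_matD[OF J] carrier_matD[OF TV])
      have e3: "?E s * - (J * ?TV) = - (?E s * (J * ?TV))"
        by (rule uminus_mult_right_mat) (simp only: carrier_matD[OF E] carrier_matD[OF JV(2)])
      have EJ: "?E s * (J * ?TV) \<in> carrier_mat (p + q) 1" "?E s * (K * (b * c * ?V s)) \<in> carrier_mat (p + q) 1"
        by (rule mult_carrier_mat[OF E JV(2)], rule mult_carrier_mat[OF E JV(3)])
      show ?thesis
        unfolding e1 e2 e3 assoc_add_mat[OF EJ(2,1) uminus_carrier_mat[OF EJ(1)]]
          comm_add_mat[OF EJ(1) uminus_carrier_mat[OF EJ(1)]]
          uminus_l_inv_mat[OF EJ(1)]
        by (rule right_add_zero_mat[OF EJ(2)])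
    qed
    also have "\<alpha> * (?E s * (K * (b * c * ?V s))) = (a * mexp (s \<cdot>\<^sub>m S) * b) * (c * mexp ((x - s) \<cdot>\<^sub>m T) * d)"
    proof -
      let ?X = "b * c * ?V s"
      have X: "?X \<in> carrier_mat p 1" using bc V by (rule mult_carrier_mat)
      have es: "mexp (s \<cdot>\<^sub>m S) \<in> carrier_mat p p" "mexp ((x - s) \<cdot>\<^sub>m T) \<in> carrier_mat q q"
        by (rule mexp_smult_carrier[OF F(2)], rule mexp_smult_carrier[OF G(2)])
      have "\<alpha> * (?E s * (K * ?X)) = \<alpha> * (K * mexp (s \<cdot>\<^sub>m S) * ?X)"
        unfolding assoc_mult_mat[OF E K X, symmetric] mexp_intertwine[OF A F(2) K AK] ..
      also have "\<dots> = a * (mexp (s \<cdot>\<^sub>m S) * ?X)"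
        unfolding assoc_mult_mat[OF K es(1) X]
          assoc_mult_mat[OF al K mult_carrier_mat[OF es(1) X], symmetric] alK ..
      also have "\<dots> = a * mexp (s \<cdot>\<^sub>m S) * (b * (c * ?V s))"
        unfolding assoc_mult_mat[OF F(3) G(1) V]
          assoc_mult_mat[OF F(1) es(1) mult_carrier_mat[OF F(3) mult_carrier_mat[OF G(1) V]]] ..
      also have "\<dots> = (a * mexp (s \<cdot>\<^sub>m S) * b) * (c * ?V s)"
        by (rule assoc_mult_mat[symmetric, OF mult_carrier_mat[OF F(1) es(1)] F(3) mult_carrier_mat[OF G(1) V]])
      also have "c * ?V s = c * mexp ((x - s) \<cdot>\<^sub>m T) * d"
        by (rule assoc_mult_mat[symmetric, OF G(1) es(2) G(3)])
      finally show ?thesis .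
    qed
    finally have "(H has_real_derivative
        ((a * mexp (s \<cdot>\<^sub>m S) * b) * (c * mexp ((x - s) \<cdot>\<^sub>m T) * d)) $$ (0,0)) (at s)"
      unfolding H_def by (rule mat_derivD(3)) auto
    also have "((a * mexp (s \<cdot>\<^sub>m S) * b) * (c * mexp ((x - s) \<cdot>\<^sub>m T) * d)) $$ (0,0)
        = me_fun a S b s * me_fun c T d (x - s)"
      unfolding me_fun_def
      by (subst mult_mat_index[OF mult_carrier_mat[OF mult_carrier_mat[OF F(1) mexp_smult_carrier[OF F(2)]] F(3)]
            mult_carrier_mat[OF mult_carrier_mat[OF G(1) mexp_smult_carrier[OF G(2)]] G(3)]]) auto
    finally show ?thesis .
  qed
  \<comment> \<open>At s = 0 the exponential is the identity, and \<alpha> has only zeros on the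
    second block.\<close>
  have H0: "H 0 = 0"
    unfolding H_def mexp_zero[OF A] left_mult_one_mat[OF mult_carrier_mat[OF J V]] alJX[OF V] by simp
  have Hx: "H x = me_fun \<alpha> A \<tau> x"
  proof -
    have "?V x = d" using mexp_zero[OF G(2)] G(3) by simp
    then have "J * ?V x = \<tau>" unfolding cs' by (simp add: JX[OF G(3)])
    then show ?thesis unfolding H_def me_fun_def by (simp add: assoc_mult_mat[OF al E ta])
  qed
  have nn: "0 \<le> me_fun a S b s * me_fun c T d (x - s)" if "0 \<le> s" "s \<le> x" for s
    using that F(5) G(5) by simp
  have "(\<integral>\<^sup>+s. ennreal (me_fun a S b s * me_fun c T d (x - s)) * indicator {0..x} s \<partial>lborel)
      = ennreal (H x - H 0)"
    using me_fun_measurable[OF f] me_fun_measurable[OF g] x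
    by (intro nn_integral_FTC_Icc) (auto intro!: H' nn has_field_derivative_at_within)
  then show ?int by (simp add: H0 Hx)
  have "H 0 \<le> H x"
    using x H' nn by (intro DERIV_nonneg_imp_nondecreasing[of 0 x H]) blast+
  then show ?nonneg by (simp add: H0 Hx)
qed

text \<open>Nonnegativity is inherited because the new function is an integral of products of the
  old ones; stability is inherited by block triangularity.\<close>

lemma me_rep_conv_step:
  assumes f: "me_rep p a S b" and g: "me_rep q c T d"
    and cs: "conv_step (a, S, b) (c, T, d) = (\<alpha>, A, \<tau>)"
  shows "me_rep (p + q) \<alpha> A \<tau>"
proof -
  note F = me_repD[OF f] and G = me_repD[OF g]
  have cs': "\<alpha> = row_cat a (0\<^sub>m 1 q)" "A = four_block_mat S (b * c) (0\<^sub>m q p) T" "\<tau> = col_cat (0\<^sub>m p 1) d"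
    using cs F(2) G(2) by (auto simp: conv_step_def)
  have "hurwitz A"
    unfolding cs' by (intro hurwitz_four_block[OF F(2) _ G(2)] F G mult_carrier_mat[OF F(3) G(1)])
  then show ?thesis
    using me_conv(2)[OF f g _ cs] F G unfolding me_rep_def by (auto simp: cs')
qed

text \<open>Substituting v = s - u and exchanging the integrals brings the test function outside;
  the two cuts at 0 confine u to [0, s], where the convolution identity applies. A test function is
  carried along so that no law of a sum has to be formed.\<close>

lemma nn_integral_conv_step:
  assumes f: "me_rep p a S b" and g: "me_rep q c T d"
    and cs: "conv_step (a, S, b) (c, T, d) = (\<alpha>, A, \<tau>)"
    and \<phi>: "\<phi> \<in> borel_measurable borel"
  shows "(\<integral>\<^sup>+u. \<integral>\<^sup>+v. \<phi> (u + v) * me_dens a S b u * me_dens c T d v \<partial>lborel \<partial>lborel)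
       = (\<integral>\<^sup>+s. \<phi> s * me_dens \<alpha> A \<tau> s \<partial>lborel)"
proof -
  note [measurable] = \<phi> me_dens_measurable[OF f] me_dens_measurable[OF g]
    me_fun_measurable[OF f] me_fun_measurable[OF g]
  have "(\<integral>\<^sup>+u. \<integral>\<^sup>+v. \<phi> (u + v) * me_dens a S b u * me_dens c T d v \<partial>lborel \<partial>lborel)
      = (\<integral>\<^sup>+u. \<integral>\<^sup>+s. \<phi> s * me_dens a S b u * me_dens c T d (s - u) \<partial>lborel \<partial>lborel)"
  proof (rule nn_integral_cong)
    fix u :: real
    show "(\<integral>\<^sup>+v. \<phi> (u + v) * me_dens a S b u * me_dens c T d v \<partial>lborel)
        = (\<integral>\<^sup>+s. \<phi> s * me_dens a S b u * me_dens c T d (s - u) \<partial>lborel)"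
      by (subst nn_integral_real_affine[of _ 1 "- u"]) auto
  qed
  also have "\<dots> = (\<integral>\<^sup>+s. \<integral>\<^sup>+u. \<phi> s * me_dens a S b u * me_dens c T d (s - u) \<partial>lborel \<partial>lborel)"
    by (rule lborel_pair.Fubini') measurable
  also have "\<dots> = (\<integral>\<^sup>+s. \<phi> s * me_dens \<alpha> A \<tau> s \<partial>lborel)"
  proof (rule nn_integral_cong)
    fix s :: real
    have "(\<integral>\<^sup>+u. \<phi> s * me_dens a S b u * me_dens c T d (s - u) \<partial>lborel)
        = \<phi> s * (\<integral>\<^sup>+u. ennreal (me_fun a S b u * me_fun c T d (s - u)) * indicator {0..s} u \<partial>lborel)"
      unfolding mult.assoc
      by (subst nn_integral_cmult)
         (auto simp: me_dens_def ennreal_mult me_repD[OF f] me_repD[OF g]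
           intro!: nn_integral_cong arg_cong[of _ _ "(*) _"] split: split_indicator)
    also have "(\<integral>\<^sup>+u. ennreal (me_fun a S b u * me_fun c T d (s - u)) * indicator {0..s} u \<partial>lborel)
        = me_dens \<alpha> A \<tau> s"
      by (cases "0 \<le> s") (simp_all add: me_conv(1)[OF f g _ cs] me_dens_def)
    finally show "(\<integral>\<^sup>+u. \<phi> s * me_dens a S b u * me_dens c T d (s - u) \<partial>lborel) = \<phi> s * me_dens \<alpha> A \<tau> s" .
  qed
  finally show ?thesis .
qed

subsection \<open>Power weights and tail moments\<close>

lemma sum_lessThan_mult:
  fixes f :: "nat \<Rightarrow> 'a :: comm_monoid_add"
  shows "(\<Sum>i<n * p. f i) = (\<Sum>q<n. \<Sum>a<p. f (q * p + a))"
proof -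
  have "(\<Sum>i<n * p. f i) = (\<Sum>q<n. sum f {q * p..<q * p + p})"
    by (rule sum.nat_group[symmetric])
  also have "\<dots> = (\<Sum>q<n. \<Sum>a<p. f (q * p + a))"
  proof (rule sum.cong[OF refl])
    show "sum f {q * p..<q * p + p} = (\<Sum>a<p. f (q * p + a))" for q
      using sum.shift_bounds_nat_ivl[of f 0 "q * p" p] by (simp add: atLeast0LessThan add.commute)
  qed
  finally show ?thesis .
qed

lemma alpha_blk_carrier [simp]: "\<alpha> \<in> carrier_mat 1 p \<Longrightarrow> alpha_blk \<alpha> k \<in> carrier_mat 1 ((k+1) * p)"
  by (auto simp: alpha_blk_def Let_def)

lemma t_blk_carrier [simp]: "t \<in> carrier_mat p 1 \<Longrightarrow> t_blk t k \<in> carrier_mat ((k+1) * p) 1"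
  by (auto simp: t_blk_def Let_def)

lemma alpha_blk_0: "\<alpha> \<in> carrier_mat 1 p \<Longrightarrow> alpha_blk \<alpha> 0 = \<alpha>"
  by (intro eq_matI) (auto simp: alpha_blk_def Let_def)

lemma t_blk_0: "t \<in> carrier_mat p 1 \<Longrightarrow> t_blk t 0 = t"
  by (intro eq_matI) (auto simp: t_blk_def Let_def)

text \<open>The blocks \<open>s ^ (k - q) / (k - q)! * mexp (s T) t\<close> solve the linear system of
  \<open>blockT T k 0\<close> with initial value \<open>t_blk t k\<close>.\<close>
lemma me_fun_blockT:
  assumes \<alpha>: "\<alpha> \<in> carrier_mat 1 p" and T: "T \<in> carrier_mat p p" and t: "t \<in> carrier_mat p 1"
  shows "me_fun (alpha_blk \<alpha> k) (blockT T k 0) (t_blk t k) x = x ^ k / fact k * me_fun \<alpha> T t x"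
proof -
  let ?n = "(k+1) * p"
  have z: "(0::nat) < 1" by simp
  note B = blockT_carrier[OF T, of k 0]
  define g where "g = (\<lambda>a s. (mexp (s \<cdot>\<^sub>m T) * t) $$ (a,0))"
  have et: "mexp (s \<cdot>\<^sub>m T) * t \<in> carrier_mat p 1" for s
    by (rule mult_carrier_mat[OF mexp_smult_carrier[OF T] t])
  have g': "(g a has_real_derivative (\<Sum>b<p. T $$ (a,b) * g b s)) (at s)" if "a < p" for a s
  proof -
    have "(g a has_real_derivative (T * mexp (s \<cdot>\<^sub>m T) * t) $$ (a,0)) (at s)"
      unfolding g_def by (rule mat_derivD(3)[OF mat_deriv_multc[OF mat_deriv_mexp[OF T] t] that]) simp
    also have "T * mexp (s \<cdot>\<^sub>m T) * t = T * (mexp (s \<cdot>\<^sub>m T) * t)"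
      by (rule assoc_mult_mat[OF T mexp_smult_carrier[OF T] t])
    also have "\<dots> $$ (a,0) = (\<Sum>b<p. T $$ (a,b) * g b s)"
      unfolding g_def by (rule mult_mat_index[OF T et that]) simp
    finally show ?thesis .
  qed
  define c where "c = (\<lambda>m (s::real). s ^ m / fact m)"
  \<comment> \<open>Row i belongs to block i div p and has position i mod p inside it; block q
    carries the power k - q, so the top block has the full power and the last block none.\<close>
  define V where "V = (\<lambda>s. Matrix.mat ?n 1 (\<lambda>(i,_). c (k - i div p) s * g (i mod p) s))"
  have V: "V s \<in> carrier_mat ?n 1" for s by (simp add: V_def)
  have lt: "q * p + a < ?n" if "q \<le> k" "a < p" for q a
  proof -
    have "q * p + a < Suc q * p" using that by simp
    also have "\<dots> \<le> ?n" using that by (intro mult_le_mono1) simp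
    finally show ?thesis .
  qed
  have Vi: "V s $$ (q * p + a, 0) = c (k - q) s * g a s" if "q \<le> k" "a < p" for q a s
  proof -
    have "(q * p + a) div p = q" "(q * p + a) mod p = a" using that by auto
    then show ?thesis unfolding V_def index_mat(1)[OF lt[OF that] z] prod.case by simp
  qed
  have dV: "mat_deriv ?n 1 V (blockT T k 0 * V s) s" for s
    unfolding mat_deriv_def
  proof (intro conjI allI impI V mult_carrier_mat[OF B V])
    fix i j :: nat assume "i < ?n" and j: "j < 1"
    define q a where "q = i div p" and "a = i mod p"
    have p: "p > 0" using \<open>i < ?n\<close> by (cases p) auto
    have q: "q \<le> k" using \<open>i < ?n\<close> unfolding q_def
      by (metis less_Suc_eq_le less_mult_imp_div_less Suc_eq_plus1)
    have a: "a < p" and i: "i = q * p + a" using p by (auto simp: q_def a_def)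
    have j0: "j = 0" using j by simp
    let ?S = "\<Sum>b<p. T $$ (a,b) * g b s"
    have "(blockT T k 0 * V s) $$ (i,j)
        = (\<Sum>q'<k+1. \<Sum>b<p. blockT T k 0 $$ (i, q' * p + b) * V s $$ (q' * p + b, 0))"
      unfolding j0 mult_mat_index[OF B V \<open>i < ?n\<close> z] sum_lessThan_mult ..
    also have "\<dots> = (\<Sum>q'<k+1. (if q' = q then c (k - q) s * ?S else 0) +
        (if q' = Suc q then c (k - q') s * g a s else 0))"
    proof (intro sum.cong refl)
      fix q' assume "q' \<in> {..<k+1}"
      then have q': "q' \<le> k" by simp
      have "(\<Sum>b<p. blockT T k 0 $$ (i, q' * p + b) * V s $$ (q' * p + b, 0))
          = (\<Sum>b<p. (if q' = q then T $$ (a,b) * (c (k - q) s * g b s) else 0)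
              + (if b = a then if q' = Suc q then c (k - q') s * g a s else 0 else 0))"
        unfolding i by (intro sum.cong refl) (auto simp: blockT_index[OF T q q' a] Vi[OF q'])
      also have "\<dots> = (if q' = q then c (k - q) s * ?S else 0)
            + (if q' = Suc q then c (k - q') s * g a s else 0)"
        using a by (simp add: sum.distrib sum_distrib_left mult_ac)
      finally show "(\<Sum>b<p. blockT T k 0 $$ (i, q' * p + b) * V s $$ (q' * p + b, 0))
          = (if q' = q then c (k - q) s * ?S else 0) + (if q' = Suc q then c (k - q') s * g a s else 0)" .
    qed
    also have "\<dots> = c (k - q) s * ?S + (if q < k then c (k - Suc q) s * g a s else 0)"
      using q by (simp add: sum.distrib)
    finally have eq: "(blockT T k 0 * V s) $$ (i,j) = \<dots>" .
    \<comment> \<open>Differentiating a power divided by its factorial gives the next lower one,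
      which is the job of the identity superdiagonal. In the last block q = k the coefficient is
      constant and no further block follows.\<close>
    have c': "(c (k - q) has_real_derivative (if q < k then c (k - Suc q) s else 0)) (at s)"
    proof (cases "q < k")
      case True
      then obtain m where m: "k - q = Suc m" "k - Suc q = m" by (metis Suc_diff_Suc)
      have "((\<lambda>s. s ^ Suc m / fact (Suc m)) has_real_derivative
          (real (Suc m) * s ^ m) / fact (Suc m)) (at s)"
        by (rule DERIV_cdivide) (use DERIV_pow[of "Suc m" s] in simp)
      then show ?thesis using True m
        by (simp add: c_def del: of_nat_Suc power_Suc)
    next
      case False
      then show ?thesis by (simp add: c_def)
    qed
    have "((\<lambda>s. c (k - q) s * g a s) has_real_derivative
        (if q < k then c (k - Suc q) s else 0) * g a s + ?S * c (k - q) s) (at s)"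
      by (rule DERIV_mult[OF c' g'[OF a]])
    moreover have "(if q < k then c (k - Suc q) s else 0) * g a s + ?S * c (k - q) s
        = (blockT T k 0 * V s) $$ (i,j)"
      unfolding eq by simp
    ultimately show "((\<lambda>s. V s $$ (i,j)) has_real_derivative (blockT T k 0 * V s) $$ (i,j)) (at s)"
      unfolding i j0 Vi[OF q a] by (simp only:)
  qed
  \<comment> \<open>At 0 every positive power vanishes, so only the last block, with exponent 0, is
    left.\<close>
  have V0: "V 0 = t_blk t k"
  proof (rule eq_matI)
    fix i j assume "i < dim_row (t_blk t k)" "j < dim_col (t_blk t k)"
    then have ij: "i < ?n" "j = 0" using t_blk_carrier[OF t, of k] by auto
    have p: "p > 0" using ij by (cases p) auto
    have q: "i div p \<le> k" using ij(1)
      by (metis less_Suc_eq_le less_mult_imp_div_less Suc_eq_plus1)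
    have a: "i mod p < p" using p by simp
    have i: "i div p * p + i mod p = i" by simp
    have g0: "g b 0 = t $$ (b,0)" for b
      unfolding g_def using mexp_zero[OF T] t by simp
    have c0: "c m 0 = (if m = 0 then 1 else 0)" for m
      by (cases m) (auto simp: c_def)
    have ge: "k * p \<le> i \<longleftrightarrow> i div p = k"
      using q p by (metis div_le_mono div_times_less_eq_dividend le_antisym nonzero_mult_div_cancel_right not_gr_zero)
    have md: "i mod p = i - k * p" if "i div p = k"
      using that by (metis minus_div_mult_eq_mod)
    have "V 0 $$ (i,j) = (if i div p = k then t $$ (i mod p,0) else 0)"
      using Vi[OF q a, of 0] q by (simp add: i ij(2) g0 c0)
    also have "\<dots> = t_blk t k $$ (i,j)"
      using ij t ge md by (auto simp: t_blk_def Let_def)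
    finally show "V 0 $$ (i,j) = t_blk t k $$ (i,j)" .
  qed (use t_blk_carrier[OF t, of k] V in auto)
  have "mexp (x \<cdot>\<^sub>m blockT T k 0) * t_blk t k = V x"
    using linear_ode_unique[OF B dV, of x] by (simp add: V0)
  then have "alpha_blk \<alpha> k * mexp (x \<cdot>\<^sub>m blockT T k 0) * t_blk t k = alpha_blk \<alpha> k * V x"
    by (simp add: assoc_mult_mat[OF alpha_blk_carrier[OF \<alpha>] mexp_smult_carrier[OF B] t_blk_carrier[OF t]])
  then have "me_fun (alpha_blk \<alpha> k) (blockT T k 0) (t_blk t k) x = (alpha_blk \<alpha> k * V x) $$ (0,0)"
    by (simp add: me_fun_def)
  also have "\<dots> = (\<Sum>q<k+1. \<Sum>a<p. alpha_blk \<alpha> k $$ (0, q * p + a) * V x $$ (q * p + a, 0))"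
    unfolding mult_mat_index[OF alpha_blk_carrier[OF \<alpha>] V z z] sum_lessThan_mult ..
  also have "\<dots> = (\<Sum>q<k+1. if q = 0 then c k x * (\<Sum>a<p. \<alpha> $$ (0,a) * g a x) else 0)"
  proof (intro sum.cong refl)
    fix q assume "q \<in> {..<k+1}"
    then have q: "q \<le> k" by simp
    have "alpha_blk \<alpha> k $$ (0, q * p + a) = (if q = 0 then \<alpha> $$ (0,a) else 0)" if "a < p" for a
      using \<alpha> lt[OF q that] that by (cases q) (auto simp: alpha_blk_def Let_def)
    then show "(\<Sum>a<p. alpha_blk \<alpha> k $$ (0, q * p + a) * V x $$ (q * p + a, 0))
        = (if q = 0 then c k x * (\<Sum>a<p. \<alpha> $$ (0,a) * g a x) else 0)"
      by (simp add: Vi[OF q] Vi[of 0 _ x, simplified] sum_distrib_left mult_ac)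
  qed
  also have "\<dots> = c k x * (\<Sum>a<p. \<alpha> $$ (0,a) * g a x)"
    by simp
  also have "(\<Sum>a<p. \<alpha> $$ (0,a) * g a x) = me_fun \<alpha> T t x"
    unfolding me_fun_def assoc_mult_mat[OF \<alpha> mexp_smult_carrier[OF T] t] g_def
    by (rule mult_mat_index[OF \<alpha> et, symmetric]) auto
  finally show ?thesis by (simp add: c_def)
qed

lemma me_rep_blockT:
  assumes "me_rep p \<alpha> T t"
  shows "me_rep ((k+1) * p) (alpha_blk \<alpha> k) (blockT T k 0) (t_blk t k)"
  unfolding me_rep_def me_fun_blockT[OF me_repD(1-3)[OF assms]]
  using hurwitz_blockT[OF me_repD(2,4)[OF assms]] me_repD(5)[OF assms]
    alpha_blk_carrier[OF me_repD(1)[OF assms]] blockT_carrier[OF me_repD(2)[OF assms]]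
    t_blk_carrier[OF me_repD(3)[OF assms]]
  by auto

text \<open>This is the integral of s^h times the matrix-exponential function over s > c, as
  repeated integration by parts produces it; the quotient of factorials collects the exponents
  differentiated away.\<close>

definition me_tail :: "nat \<Rightarrow> real mat \<Rightarrow> real mat \<Rightarrow> real mat \<Rightarrow> real \<Rightarrow> real" where
  "me_tail h \<alpha> A t c = (\<Sum>l=0..h. fact h / fact l * c ^ l *
     (\<alpha> * (minv (- A) ^\<^sub>m (h - l + 1) * mexp (c \<cdot>\<^sub>m A)) * t) $$ (0,0))"

lemma power_mult_exp_neg_tendsto_0:
  fixes \<epsilon> :: real
  assumes "0 < \<epsilon>"
  shows "((\<lambda>s. s ^ l * exp (- \<epsilon> * s)) \<longlongrightarrow> 0) at_top"
proof -
  have "filterlim (\<lambda>s. \<epsilon> * s) at_top at_top"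
    by (rule filterlim_tendsto_pos_mult_at_top[OF tendsto_const assms filterlim_ident])
  from filterlim_compose[OF tendsto_power_div_exp_0 this]
  have "((\<lambda>s. inverse \<epsilon> ^ l * ((\<epsilon> * s) ^ l / exp (\<epsilon> * s))) \<longlongrightarrow> inverse \<epsilon> ^ l * 0) at_top"
    by (intro tendsto_mult tendsto_const)
  moreover have "inverse \<epsilon> ^ l * ((\<epsilon> * s) ^ l / exp (\<epsilon> * s)) = s ^ l * exp (- \<epsilon> * s)" for s
    using assms by (simp add: power_mult_distrib exp_minus field_simps)
  ultimately show ?thesis by simp
qed

lemma nn_integral_me_tail:
  assumes r: "me_rep n \<alpha> A t" and c: "0 \<le> c"
  shows "(\<integral>\<^sup>+s. ennreal (s ^ h * indicator {c<..} s) * me_dens \<alpha> A t s \<partial>lborel) = ennreal (me_tail h \<alpha> A t c)"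
    and "0 \<le> me_tail h \<alpha> A t c"
proof -
  note R = me_repD[OF r]
  note N = minv_hurwitz[OF R(2,4)]
  \<comment> \<open>A ladder of primitives: raising m by one multiplies by the inverse of -A, so
    \<open>g (Suc m)\<close> has derivative \<open>- g m\<close>, and \<open>g 0\<close> is the
    given function.\<close>
  define g where "g = (\<lambda>m s. (\<alpha> * (minv (- A) ^\<^sub>m m * mexp (s \<cdot>\<^sub>m A)) * t) $$ (0,0))"
  have Nm: "minv (- A) ^\<^sub>m m \<in> carrier_mat n n" for m using N(1) by (rule pow_carrier_mat)
  have E: "mexp (s \<cdot>\<^sub>m A) \<in> carrier_mat n n" for s using R(2) by (rule mexp_smult_carrier)
  have aN: "\<alpha> * minv (- A) ^\<^sub>m m \<in> carrier_mat 1 n" for m using R(1) Nm by (rule mult_carrier_mat)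
  have g_alt: "g m s = (\<alpha> * minv (- A) ^\<^sub>m m * mexp (s \<cdot>\<^sub>m A) * t) $$ (0,0)" for m s
    unfolding g_def assoc_mult_mat[OF R(1) Nm E] ..
  have g': "(g (Suc m) has_real_derivative - g m s) (at s)" for m s
  proof -
    have "(g (Suc m) has_real_derivative
        (\<alpha> * minv (- A) ^\<^sub>m Suc m * (A * mexp (s \<cdot>\<^sub>m A)) * t) $$ (0,0)) (at s)"
      unfolding g_alt by (rule bilinear_mexp_deriv[OF aN R(2,3)])
    also have "\<alpha> * minv (- A) ^\<^sub>m Suc m * (A * mexp (s \<cdot>\<^sub>m A)) = - (\<alpha> * (minv (- A) ^\<^sub>m m * mexp (s \<cdot>\<^sub>m A)))"
    proof -
      have "\<alpha> * minv (- A) ^\<^sub>m Suc m * (A * mexp (s \<cdot>\<^sub>m A))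
          = \<alpha> * (minv (- A) ^\<^sub>m m * (minv (- A) * A)) * mexp (s \<cdot>\<^sub>m A)"
        unfolding pow_mat.simps assoc_mult_mat[OF aN R(2) E, symmetric, unfolded pow_mat.simps]
          assoc_mult_mat[OF mult_carrier_mat[OF R(1) mult_carrier_mat[OF Nm N(1)]] R(2) E, symmetric]
          assoc_mult_mat[OF R(1) mult_carrier_mat[OF Nm N(1)] R(2)] assoc_mult_mat[OF Nm N(1) R(2)] ..
      also have "minv (- A) ^\<^sub>m m * (minv (- A) * A) = - (minv (- A) ^\<^sub>m m)"
        unfolding N(2) using carrier_matD[OF Nm[of m]] Nm[of m] by simp
      also have "\<alpha> * - (minv (- A) ^\<^sub>m m) * mexp (s \<cdot>\<^sub>m A) = - (\<alpha> * minv (- A) ^\<^sub>m m * mexp (s \<cdot>\<^sub>m A))"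
        using carrier_matD[OF Nm[of m]] carrier_matD[OF R(1)] carrier_matD[OF E[of s]] by simp
      finally show ?thesis unfolding assoc_mult_mat[OF R(1) Nm E] .
    qed
    also have "(- (\<alpha> * (minv (- A) ^\<^sub>m m * mexp (s \<cdot>\<^sub>m A))) * t) $$ (0,0) = - g m s"
      unfolding g_def using carrier_matD[OF R(1)] carrier_matD[OF R(3)] carrier_matD[OF E[of s]] by simp
    finally show ?thesis .
  qed
  have g_decay: "((\<lambda>s. s ^ l * g m s) \<longlongrightarrow> 0) at_top" for l m
  proof -
    obtain C \<epsilon> where e: "0 < \<epsilon>" "0 \<le> C" "\<And>s. 0 \<le> s \<Longrightarrow> \<bar>g m s\<bar> \<le> C * exp (- \<epsilon> * s)"
      unfolding g_alt by (rule bilinear_mexp_decay[OF aN[of m] R(2,3,4)]) blast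
    have "((\<lambda>s. C * (s ^ l * exp (- \<epsilon> * s))) \<longlongrightarrow> C * 0) at_top"
      by (intro tendsto_mult tendsto_const power_mult_exp_neg_tendsto_0 e(1))
    then have lim: "((\<lambda>s. C * (s ^ l * exp (- \<epsilon> * s))) \<longlongrightarrow> 0) at_top" by simp
    have "\<forall>\<^sub>F s in at_top. norm (s ^ l * g m s) \<le> C * (s ^ l * exp (- \<epsilon> * s))"
      using eventually_ge_at_top[of 0]
    proof eventually_elim
      case (elim s)
      from mult_left_mono[OF e(3)[OF elim], of "s ^ l"] elim
      show ?case by (simp add: abs_mult mult_ac)
    qed
    from Lim_null_comparison[OF this lim] show ?thesis .
  qed
  define H where "H = (\<lambda>s. - (\<Sum>l=0..h. fact h / fact l * s ^ l * g (h - l + 1) s))"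
  have g0: "g 0 s = me_fun \<alpha> A t s" for s
    unfolding g_def me_fun_def using left_mult_one_mat[OF E[of s]] N(1) by simp
  have H': "(H has_real_derivative s ^ h * me_fun \<alpha> A t s) (at s)" for s
  proof -
    let ?d = "\<lambda>l. fact h / fact l * (real l * s ^ (l - 1) * g (h - l + 1) s - s ^ l * g (h - l) s)"
    have "(H has_real_derivative - (\<Sum>l=0..h. ?d l)) (at s)"
      unfolding H_def mult.assoc
    proof (intro DERIV_minus DERIV_sum DERIV_cmult)
      fix l
      show "((\<lambda>s. s ^ l * g (h - l + 1) s) has_real_derivative
          real l * (s ^ (l - 1) * g (h - l + 1) s) - s ^ l * g (h - l) s) (at s)"
        using DERIV_mult[OF DERIV_pow[of l s UNIV] g'[of "h - l" s]] by (simp add: mult_ac)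
    qed
    \<comment> \<open>The derivatives telescope: the first part of term l cancels the second part of
      term l - 1. At m = h only the top term with \<open>g 0\<close> is left. The truncated exponent
      at l = 0 is harmless because its factor is 0.\<close>
    moreover have "(\<Sum>l=0..m. ?d l) = - (fact h / fact m * s ^ m * g (h - m) s)" if "m \<le> h" for m
      using that
    proof (induction m)
      case 0
      then show ?case by simp
    next
      case (Suc m)
      then have "h - Suc m + 1 = h - m" by simp
      moreover have "fact h / fact (Suc m) * (real (Suc m) * z) = fact h / fact m * z" for z :: real
        by (simp add: field_simps del: of_nat_Suc)
      ultimately show ?case using Suc by (simp add: right_diff_distrib mult.assoc del: of_nat_Suc fact_Suc)
    qed
    from this[of h] have "- (\<Sum>l=0..h. ?d l) = s ^ h * me_fun \<alpha> A t s" by (simp add: g0)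
    ultimately show ?thesis by simp
  qed
  have lim: "(H \<longlongrightarrow> 0) at_top"
  proof -
    have "((\<lambda>s. - (\<Sum>l=0..h. fact h / fact l * (s ^ l * g (h - l + 1) s)))
        \<longlongrightarrow> - (\<Sum>l=0..h. fact h / fact l * 0)) at_top"
      by (intro tendsto_minus tendsto_sum tendsto_mult tendsto_const g_decay)
    then show ?thesis by (simp add: H_def mult.assoc)
  qed
  have Hc: "me_tail h \<alpha> A t c = - H c"
    by (simp add: H_def me_tail_def g_def)
  have nn: "0 \<le> s ^ h * me_fun \<alpha> A t s" if "c \<le> s" for s
    using that c R(5) by simp
  have "(\<integral>\<^sup>+s. ennreal (s ^ h * indicator {c<..} s) * me_dens \<alpha> A t s \<partial>lborel)
      = (\<integral>\<^sup>+s. ennreal (s ^ h * me_fun \<alpha> A t s) * indicator {c..} s \<partial>lborel)"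
    \<comment> \<open>The event is a strict inequality while the fundamental theorem is stated on a
      closed half line; the endpoint is a null set.\<close>
    using AE_lborel_singleton[of c] c
    by (intro nn_integral_cong_AE) (auto simp: me_dens_def ennreal_mult R(5) split: split_indicator)
  also have "\<dots> = ennreal (0 - H c)"
    using me_fun_measurable[OF r] by (intro nn_integral_FTC_atLeast H' nn lim) auto
  finally show "(\<integral>\<^sup>+s. ennreal (s ^ h * indicator {c<..} s) * me_dens \<alpha> A t s \<partial>lborel) = ennreal (me_tail h \<alpha> A t c)"
    by (simp add: Hc)
  have "H c \<le> 0"
  proof (rule tendsto_lowerbound[OF lim])
    show "\<forall>\<^sub>F s in at_top. H c \<le> H s"
      using eventually_ge_at_top[of c]
    proof eventually_elim
      case (elim s)
      then show ?case using H' nn by (intro DERIV_nonneg_imp_nondecreasing[of c s H]) blast+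
    qed
  qed simp
  then show "0 \<le> me_tail h \<alpha> A t c" by (simp add: Hc)
qed

text \<open>The two definitions read the sizes of their zero blocks off different matrices; they
  agree once all sizes are known to be consistent.\<close>

lemma conv_triple_Cons:
  assumes "me_rep p (a k) (T k) (t k)"
    and "me_rep q (ct_alpha a T t (k' # ks)) (ct_T a T t (k' # ks)) (ct_t a T t (k' # ks))"
  shows "conv_triple a T t (k # k' # ks) = conv_step (a k, T k, t k) (conv_triple a T t (k' # ks))"
proof -
  obtain a' T' t' where e: "conv_triple a T t (k' # ks) = (a', T', t')"
    by (cases "conv_triple a T t (k' # ks)")
  have "a' \<in> carrier_mat 1 q" "T' \<in> carrier_mat q q"
    using me_repD(1,2)[OF assms(2)] by (auto simp: e)
  then show ?thesis
    using me_repD(2,3)[OF assms(1)] by (simp add: e conv_step_def)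
qed

lemma me_rep_conv_triple:
  assumes "ks \<noteq> []" and "\<And>k. k \<in> set ks \<Longrightarrow> me_rep (n k) (a k) (T k) (t k)"
  shows "\<exists>q. me_rep q (ct_alpha a T t ks) (ct_T a T t ks) (ct_t a T t ks)"
  using assms
proof (induction ks rule: induct_list012)
  case (2 k)
  then show ?case by (auto simp del: split_paired_Ex)
next
  case (3 k k' ks)
  then obtain q where q: "me_rep q (ct_alpha a T t (k' # ks)) (ct_T a T t (k' # ks)) (ct_t a T t (k' # ks))"
    by auto
  have k: "me_rep (n k) (a k) (T k) (t k)" using 3 by simp
  have "me_rep (n k + q) (ct_alpha a T t (k # k' # ks)) (ct_T a T t (k # k' # ks)) (ct_t a T t (k # k' # ks))"
    by (rule me_rep_conv_step[OF k q]) (simp add: conv_triple_Cons[OF k q] del: conv_triple.simps)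
  then show ?case by blast
qed auto

subsection \<open>Integration over the components and over the scaling variable\<close>

text \<open>Separates one coordinate, with its own factor \<open>e\<close>, from the others. It is
  used for the recursion along a word and also to give the distinguished coordinate a weighted
  density, wherever it stands. The hypothesis ranges over all test functions because it is applied
  to the translates by u.\<close>

lemma nn_integral_PiM_insert_sum:
  fixes d :: "nat \<Rightarrow> real \<Rightarrow> ennreal" and e D \<phi> :: "real \<Rightarrow> ennreal"
  assumes I: "finite I" "j \<notin> I"
    and d: "\<And>i. i \<in> I \<Longrightarrow> d i \<in> borel_measurable borel"
    and e [measurable]: "e \<in> borel_measurable borel"
    and \<phi> [measurable]: "\<phi> \<in> borel_measurable borel"
    and D: "\<And>\<psi>. \<psi> \<in> borel_measurable borel \<Longrightarrow>
      (\<integral>\<^sup>+x. \<psi> (\<Sum>i\<in>I. x i) * (\<Prod>i\<in>I. d i (x i)) \<partial>PiM I (\<lambda>_. lborel)) = (\<integral>\<^sup>+v. \<psi> v * D v \<partial>lborel)"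
  shows "(\<integral>\<^sup>+x. \<phi> (\<Sum>i\<in>insert j I. x i) * (e (x j) * (\<Prod>i\<in>I. d i (x i))) \<partial>PiM (insert j I) (\<lambda>_. lborel))
      = (\<integral>\<^sup>+u. \<integral>\<^sup>+v. \<phi> (u + v) * e u * D v \<partial>lborel \<partial>lborel)"
proof -
  interpret product_sigma_finite "\<lambda>_::nat. lborel :: real measure"
    by (rule product_sigma_finite.intro) (rule sigma_finite_lborel)
  have [measurable]: "(\<lambda>x. \<Prod>i\<in>I. d i (x i)) \<in> borel_measurable (PiM (insert j I) (\<lambda>_. lborel))"
    by (intro borel_measurable_prod_ennreal measurable_compose[OF measurable_component_singleton])
       (use d in auto)
  have "(\<integral>\<^sup>+x. \<phi> (\<Sum>i\<in>insert j I. x i) * (e (x j) * (\<Prod>i\<in>I. d i (x i))) \<partial>PiM (insert j I) (\<lambda>_. lborel))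
      = (\<integral>\<^sup>+u. \<integral>\<^sup>+x. \<phi> (\<Sum>i\<in>insert j I. (x(j := u)) i) * (e ((x(j := u)) j) * (\<Prod>i\<in>I. d i ((x(j := u)) i)))
          \<partial>PiM I (\<lambda>_. lborel) \<partial>lborel)"
    by (rule product_nn_integral_insert_rev[OF I]) measurable
  also have "\<dots> = (\<integral>\<^sup>+u. \<integral>\<^sup>+v. \<phi> (u + v) * e u * D v \<partial>lborel \<partial>lborel)"
  proof (rule nn_integral_cong)
    fix u :: real
    have sum: "(\<Sum>i\<in>insert j I. (x(j := u)) i) = u + (\<Sum>i\<in>I. x i)" for x :: "nat \<Rightarrow> real"
      using I by (subst sum.insert) (auto intro!: sum.cong)
    have prod: "(\<Prod>i\<in>I. d i ((x(j := u)) i)) = (\<Prod>i\<in>I. d i (x i))" for x :: "nat \<Rightarrow> real"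
      using I by (intro prod.cong) auto
    show "(\<integral>\<^sup>+x. \<phi> (\<Sum>i\<in>insert j I. (x(j := u)) i) * (e ((x(j := u)) j) * (\<Prod>i\<in>I. d i ((x(j := u)) i)))
          \<partial>PiM I (\<lambda>_. lborel)) = (\<integral>\<^sup>+v. \<phi> (u + v) * e u * D v \<partial>lborel)"
      unfolding sum prod using D[of "\<lambda>v. \<phi> (u + v) * e u"] by (simp add: mult.assoc)
  qed
  finally show ?thesis .
qed

text \<open>\<open>ms\<close> lists coordinates and \<open>\<kappa>\<close> assigns to each the
  index of its density. Coordinates are distinct though indices may repeat, and the order of the
  list fixes the order of the blocks.\<close>

lemma nn_integral_PiM_conv_triple:
  fixes ms :: "nat list"
  assumes "ms \<noteq> []" "distinct ms"
    and "\<And>m. m \<in> set ms \<Longrightarrow> me_rep (n (\<kappa> m)) (a (\<kappa> m)) (T (\<kappa> m)) (t (\<kappa> m))"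
    and "\<phi> \<in> borel_measurable borel"
  shows "(\<integral>\<^sup>+x. \<phi> (\<Sum>m\<in>set ms. x m) * (\<Prod>m\<in>set ms. me_dens (a (\<kappa> m)) (T (\<kappa> m)) (t (\<kappa> m)) (x m))
        \<partial>PiM (set ms) (\<lambda>_. lborel))
      = (\<integral>\<^sup>+s. \<phi> s * me_dens (ct_alpha a T t (map \<kappa> ms)) (ct_T a T t (map \<kappa> ms)) (ct_t a T t (map \<kappa> ms)) s \<partial>lborel)"
  using assms
proof (induction ms arbitrary: \<phi> rule: induct_list012)
  case (2 m)
  interpret product_sigma_finite "\<lambda>_::nat. lborel :: real measure"
    by (rule product_sigma_finite.intro) (rule sigma_finite_lborel)
  have [measurable]: "me_dens (a (\<kappa> m)) (T (\<kappa> m)) (t (\<kappa> m)) \<in> borel_measurable borel" "\<phi> \<in> borel_measurable borel"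
    using 2 me_dens_measurable by auto
  show ?case
    using product_nn_integral_singleton[of "\<lambda>s. \<phi> s * me_dens (a (\<kappa> m)) (T (\<kappa> m)) (t (\<kappa> m)) s"] by simp
next
  case (3 m m' ms)
  let ?k = "\<kappa> m" and ?ks = "map \<kappa> (m' # ms)"
  have k: "me_rep (n ?k) (a ?k) (T ?k) (t ?k)" using 3 by simp
  have "\<exists>q. me_rep q (ct_alpha a T t ?ks) (ct_T a T t ?ks) (ct_t a T t ?ks)"
    using 3 by (intro me_rep_conv_triple[where n = n]) auto
  then obtain q where q: "me_rep q (ct_alpha a T t ?ks) (ct_T a T t ?ks) (ct_t a T t ?ks)" ..
  have cs: "conv_triple a T t (map \<kappa> (m # m' # ms)) = conv_step (a ?k, T ?k, t ?k) (conv_triple a T t ?ks)"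
    using conv_triple_Cons[where a = a and T = T and t = t, OF k, of q "\<kappa> m'" "map \<kappa> ms"] q by simp
  have "(\<integral>\<^sup>+x. \<phi> (\<Sum>m\<in>insert m (set (m' # ms)). x m) * (me_dens (a ?k) (T ?k) (t ?k) (x m) *
         (\<Prod>m\<in>set (m' # ms). me_dens (a (\<kappa> m)) (T (\<kappa> m)) (t (\<kappa> m)) (x m)))
        \<partial>PiM (insert m (set (m' # ms))) (\<lambda>_. lborel))
      = (\<integral>\<^sup>+u. \<integral>\<^sup>+v. \<phi> (u + v) * me_dens (a ?k) (T ?k) (t ?k) u *
          me_dens (ct_alpha a T t ?ks) (ct_T a T t ?ks) (ct_t a T t ?ks) v \<partial>lborel \<partial>lborel)"
  proof (rule nn_integral_PiM_insert_sum)
    show "me_dens (a (\<kappa> i)) (T (\<kappa> i)) (t (\<kappa> i)) \<in> borel_measurable borel" if "i \<in> set (m' # ms)" for i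
      using that 3 by (intro me_dens_measurable[of "n (\<kappa> i)"]) auto
    show "me_dens (a ?k) (T ?k) (t ?k) \<in> borel_measurable borel" by (rule me_dens_measurable[OF k])
    show "(\<integral>\<^sup>+x. \<psi> (\<Sum>m\<in>set (m' # ms). x m) *
          (\<Prod>m\<in>set (m' # ms). me_dens (a (\<kappa> m)) (T (\<kappa> m)) (t (\<kappa> m)) (x m)) \<partial>PiM (set (m' # ms)) (\<lambda>_. lborel))
        = (\<integral>\<^sup>+v. \<psi> v * me_dens (ct_alpha a T t ?ks) (ct_T a T t ?ks) (ct_t a T t ?ks) v \<partial>lborel)"
      if "\<psi> \<in> borel_measurable borel" for \<psi>
      using that 3 by (intro 3(2)) auto
  qed (use 3 in auto)
  also have "\<dots> = (\<integral>\<^sup>+s. \<phi> s * me_dens (ct_alpha a T t (map \<kappa> (m # m' # ms)))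
      (ct_T a T t (map \<kappa> (m # m' # ms))) (ct_t a T t (map \<kappa> (m # m' # ms))) s \<partial>lborel)"
    by (rule nn_integral_conv_step[OF k q _ 3(6)]) (simp only: cs prod.collapse)
  also have "(\<lambda>x. \<phi> (\<Sum>m\<in>insert m (set (m' # ms)). x m) * (me_dens (a ?k) (T ?k) (t ?k) (x m) *
         (\<Prod>m\<in>set (m' # ms). me_dens (a (\<kappa> m)) (T (\<kappa> m)) (t (\<kappa> m)) (x m))))
       = (\<lambda>x. \<phi> (\<Sum>m\<in>set (m # m' # ms). x m) *
         (\<Prod>m\<in>set (m # m' # ms). me_dens (a (\<kappa> m)) (T (\<kappa> m)) (t (\<kappa> m)) (x m)))"
    using 3(4) by (simp add: fun_eq_iff)
  finally show ?case by (simp only: list.set)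
qed simp

text \<open>Stability bounds the exponential by a constant for nonnegative arguments, and a negative
  power of order m \<le> K is at most 1 plus the one of order K, by cases on whether 1/r exceeds 1.
  One moment of order K therefore serves every l.\<close>

lemma integrable_powi_mexp:
  assumes A: "A \<in> carrier_mat n n" "hurwitz A" and y: "0 \<le> y"
    and G: "prob_space G" "sets G = sets borel" "AE r in G. 0 < r"
    and int: "integrable G (\<lambda>r. inverse r ^ K)" and m: "m \<le> K" and ij: "i < n" "j < n"
  shows "integrable G (\<lambda>r::real. r powi (- int m) * mexp ((r * y) \<cdot>\<^sub>m A) $$ (i,j))"
proof -
  interpret prob_space G by (rule G)
  obtain C \<epsilon> where e: "0 < \<epsilon>" "0 \<le> C"
    "\<And>x i j. 0 \<le> x \<Longrightarrow> i < n \<Longrightarrow> j < n \<Longrightarrow> \<bar>mexp (x \<cdot>\<^sub>m A) $$ (i,j)\<bar> \<le> C * exp (- \<epsilon> * x)"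
    by (rule mexp_decay[OF A]) blast
  have bd: "\<bar>mexp (x \<cdot>\<^sub>m A) $$ (i,j)\<bar> \<le> C" if "0 \<le> x" for x
  proof -
    have "C * exp (- \<epsilon> * x) \<le> C * 1" using e that by (intro mult_left_mono) auto
    with e(3)[OF that ij] show ?thesis by simp
  qed
  have "(\<lambda>x. mexp (x \<cdot>\<^sub>m A) $$ (i,j)) \<in> borel_measurable borel"
    using mat_derivD(3)[OF mat_deriv_mexp[OF A(1)] ij]
    by (intro borel_measurable_continuous_onI continuous_at_imp_continuous_on ballI) (rule DERIV_isCont)
  then have [measurable]: "(\<lambda>r. mexp ((r * y) \<cdot>\<^sub>m A) $$ (i,j)) \<in> borel_measurable borel"
    by (rule measurable_compose[rotated]) measurable
  have eq: "r powi (- int m) = inverse r ^ m" for r :: real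
    by (simp add: power_int_minus power_inverse)
  have "integrable G (\<lambda>r. C * (1 + inverse r ^ K))"
    using int by (intro integrable_mult_right Bochner_Integration.integrable_add) auto
  then show ?thesis
  proof (rule Bochner_Integration.integrable_bound)
    show "(\<lambda>r::real. r powi (- int m) * mexp ((r * y) \<cdot>\<^sub>m A) $$ (i,j)) \<in> borel_measurable G"
      unfolding eq measurable_cong_sets[OF G(2) refl] by measurable
    show "AE r in G. norm (r powi (- int m) * mexp ((r * y) \<cdot>\<^sub>m A) $$ (i,j)) \<le> norm (C * (1 + inverse r ^ K))"
      using G(3)
    proof eventually_elim
      case (elim r)
      have "inverse r ^ m \<le> 1 + inverse r ^ K"
      proof (cases "inverse r \<le> 1")
        case True
        then have "inverse r ^ m \<le> 1" using elim by (intro power_le_one) auto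
        also have "\<dots> \<le> 1 + inverse r ^ K" using elim by simp
        finally show ?thesis .
      next
        case False
        then have "inverse r ^ m \<le> inverse r ^ K" by (intro power_increasing m) auto
        then show ?thesis by simp
      qed
      then have "inverse r ^ m * \<bar>mexp ((r * y) \<cdot>\<^sub>m A) $$ (i,j)\<bar> \<le> (1 + inverse r ^ K) * C"
        using elim y e(2) by (intro mult_mono bd) auto
      then show ?case using elim e(2) by (simp add: eq abs_mult mult.commute)
    qed
  qed
qed

lemma Gcal_index:
  assumes A: "A \<in> carrier_mat n n" and ij: "i < n" "j < n"
  shows "Gcal G m (- (y \<cdot>\<^sub>m A)) $$ (i,j) = (\<integral>r. r powi m * mexp ((r * y) \<cdot>\<^sub>m A) $$ (i,j) \<partial>G)"
proof -
  have "- (r \<cdot>\<^sub>m - (y \<cdot>\<^sub>m A)) = (r * y) \<cdot>\<^sub>m A" for r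
    by (intro eq_matI) auto
  then show ?thesis using A ij by (simp add: Gcal_def)
qed

text \<open>Integrating the unscaled tail at y r against the law of the scaling variable: the powers
  of r combine to l - k - h, and the integral passes to the matrix entries, where it is the
  transform by definition.\<close>

lemma Gcal_me_tail:
  assumes r: "me_rep n \<alpha> A t" and y: "0 \<le> y"
    and G: "prob_space G" "sets G = sets borel" "AE r in G. 0 < r"
    and int: "integrable G (\<lambda>r. inverse r ^ (k + h))"
  shows "integrable G (\<lambda>r. inverse r ^ (k + h) * me_tail h \<alpha> A t (y * r))" (is ?int)
    and "(\<integral>r. inverse r ^ (k + h) * me_tail h \<alpha> A t (y * r) \<partial>G) =
      (\<alpha> * msum n n (\<lambda>l. (fact h / fact l * y ^ l) \<cdot>\<^sub>m
          (minv (- A) ^\<^sub>m (h - l + 1) * Gcal G (int l - int k - int h) (- (y \<cdot>\<^sub>m A)))) {0..h} * t) $$ (0,0)"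
      (is "_ = ?rhs")
proof -
  note R = me_repD[OF r]
  define N where "N = (\<lambda>l. minv (- A) ^\<^sub>m (h - l + 1))"
  define \<beta> where "\<beta> = (\<lambda>l. \<alpha> * N l)"
  have N: "N l \<in> carrier_mat n n" for l
    unfolding N_def by (rule pow_carrier_mat[OF minv_hurwitz(1)[OF R(2,4)]])
  have \<beta>: "\<beta> l \<in> carrier_mat 1 n" for l
    unfolding \<beta>_def by (rule mult_carrier_mat[OF R(1) N])
  let ?m = "\<lambda>l. int l - int k - int h"
  let ?c = "\<lambda>l. fact h / fact l * y ^ l"
  \<comment> \<open>Written out over the entries, so that linearity of the integral meets only
    scalar functions.\<close>
  define E where "E = (\<lambda>l r. \<Sum>i<n. \<Sum>j<n. \<beta> l $$ (0,i) * (r powi ?m l * mexp ((r * y) \<cdot>\<^sub>m A) $$ (i,j)) * t $$ (j,0))"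
  have m: "?m l = - int (k + h - l)" if "l \<le> h" for l
    using that by (simp add: of_nat_diff)
  have i0: "integrable G (\<lambda>r. r powi ?m l * mexp ((r * y) \<cdot>\<^sub>m A) $$ (i,j))" if "l \<le> h" "i < n" "j < n" for l i j
    unfolding m[OF that(1)] by (rule integrable_powi_mexp[OF R(2,4) y G int _ that(2,3)]) simp
  have iE: "integrable G (E l)" if "l \<le> h" for l
    unfolding E_def by (intro Bochner_Integration.integrable_sum integrable_mult_left integrable_mult_right i0 that) auto
  have "(\<integral>r. E l r \<partial>G) = (\<alpha> * (N l * Gcal G (?m l) (- (y \<cdot>\<^sub>m A))) * t) $$ (0,0)" if "l \<le> h" for l
  proof -
    have Gc: "Gcal G (?m l) (- (y \<cdot>\<^sub>m A)) \<in> carrier_mat n n" using R(2) by (simp add: Gcal_def)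
    have I: "integrable G (\<lambda>r. \<beta> l $$ (0,i) * (r powi ?m l * mexp ((r * y) \<cdot>\<^sub>m A) $$ (i,j)) * t $$ (j,0))"
      if "i < n" "j < n" for i j
      by (intro integrable_mult_left integrable_mult_right i0 that \<open>l \<le> h\<close>)
    have "(\<integral>r. E l r \<partial>G) = (\<Sum>i<n. \<integral>r. (\<Sum>j<n.
        \<beta> l $$ (0,i) * (r powi ?m l * mexp ((r * y) \<cdot>\<^sub>m A) $$ (i,j)) * t $$ (j,0)) \<partial>G)"
      unfolding E_def by (rule Bochner_Integration.integral_sum) (auto intro!: Bochner_Integration.integrable_sum I)
    also have "\<dots> = (\<Sum>i<n. \<Sum>j<n. \<integral>r.
        \<beta> l $$ (0,i) * (r powi ?m l * mexp ((r * y) \<cdot>\<^sub>m A) $$ (i,j)) * t $$ (j,0) \<partial>G)"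
      by (intro sum.cong refl Bochner_Integration.integral_sum I) auto
    also have "\<dots> = (\<Sum>i<n. \<Sum>j<n. \<beta> l $$ (0,i) * (\<integral>r. r powi ?m l * mexp ((r * y) \<cdot>\<^sub>m A) $$ (i,j) \<partial>G) * t $$ (j,0))"
      by simp
    also have "\<dots> = (\<beta> l * Gcal G (?m l) (- (y \<cdot>\<^sub>m A)) * t) $$ (0,0)"
      unfolding bilinear_index[OF \<beta> Gc R(3)] by (simp add: Gcal_index[OF R(2)])
    finally show ?thesis
      unfolding \<beta>_def assoc_mult_mat[OF R(1) N Gc] .
  qed
  note intE = this
  \<comment> \<open>Restricted to r > 0: with division by zero equal to 0, combining the powers can
    fail at r = 0. The law gives no mass to r \<le> 0.\<close>
  have tail: "inverse r ^ (k + h) * me_tail h \<alpha> A t (y * r) = (\<Sum>l=0..h. ?c l * E l r)" if "0 < r" for r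
  proof -
    have "inverse r ^ (k + h) * me_tail h \<alpha> A t (y * r)
        = (\<Sum>l=0..h. ?c l * (r powi ?m l * (\<alpha> * (N l * mexp ((y * r) \<cdot>\<^sub>m A)) * t) $$ (0,0)))"
      unfolding me_tail_def sum_distrib_left N_def
    proof (intro sum.cong refl)
      fix l assume "l \<in> {0..h}"
      then have "r powi ?m l = inverse r ^ (k + h) * r ^ l"
        using that by (simp add: power_int_diff power_int_add power_inverse power_add field_simps)
      then show "inverse r ^ (k + h) * (fact h / fact l * (y * r) ^ l *
          (\<alpha> * (minv (- A) ^\<^sub>m (h - l + 1) * mexp ((y * r) \<cdot>\<^sub>m A)) * t) $$ (0,0))
        = ?c l * (r powi ?m l * (\<alpha> * (minv (- A) ^\<^sub>m (h - l + 1) * mexp ((y * r) \<cdot>\<^sub>m A)) * t) $$ (0,0))"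
        by (simp only: power_mult_distrib) (simp add: mult_ac)
    qed
    also have "\<dots> = (\<Sum>l=0..h. ?c l * E l r)"
    proof (intro sum.cong refl arg_cong2[of _ _ _ _ "(*)"])
      fix l
      have "(\<alpha> * (N l * mexp ((y * r) \<cdot>\<^sub>m A)) * t) $$ (0,0)
          = (\<Sum>i<n. \<Sum>j<n. \<beta> l $$ (0,i) * mexp ((r * y) \<cdot>\<^sub>m A) $$ (i,j) * t $$ (j,0))"
        using bilinear_index[OF \<beta>[of l] mexp_smult_carrier[OF R(2), of "r * y"] R(3)]
          assoc_mult_mat[OF R(1) N[of l] mexp_smult_carrier[OF R(2), of "r * y"]]
        by (simp add: \<beta>_def mult.commute[of y r])
      then show "r powi ?m l * (\<alpha> * (N l * mexp ((y * r) \<cdot>\<^sub>m A)) * t) $$ (0,0) = E l r"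
        unfolding E_def by (simp add: sum_distrib_left mult_ac)
    qed
    finally show ?thesis .
  qed
  have AE: "AE r in G. inverse r ^ (k + h) * me_tail h \<alpha> A t (y * r) = (\<Sum>l=0..h. ?c l * E l r)"
    using G(3) by eventually_elim (rule tail)
  have iS: "integrable G (\<lambda>r. \<Sum>l=0..h. ?c l * E l r)"
    by (intro Bochner_Integration.integrable_sum integrable_mult_right iE) auto
  have "(\<lambda>r. me_tail h \<alpha> A t (y * r)) \<in> borel_measurable borel"
  proof -
    have "(\<lambda>s. (\<alpha> * (minv (- A) ^\<^sub>m (h - l + 1) * mexp (s \<cdot>\<^sub>m A)) * t) $$ (0,0)) \<in> borel_measurable borel" for l
      unfolding assoc_mult_mat[OF R(1) N[unfolded N_def] mexp_smult_carrier[OF R(2)], symmetric]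
      by (intro borel_measurable_continuous_onI continuous_at_imp_continuous_on ballI
          DERIV_isCont[OF bilinear_mexp_deriv[OF \<beta>[unfolded \<beta>_def N_def] R(2,3)]])
    then have "me_tail h \<alpha> A t \<in> borel_measurable borel"
      unfolding me_tail_def by measurable
    then show ?thesis by measurable
  qed
  then have meas: "(\<lambda>r. inverse r ^ (k + h) * me_tail h \<alpha> A t (y * r)) \<in> borel_measurable G"
    unfolding measurable_cong_sets[OF G(2) refl] by measurable
  show ?int
    using integrable_cong_AE[OF meas borel_measurable_integrable[OF iS] AE] iS by simp
  have "(\<integral>r. inverse r ^ (k + h) * me_tail h \<alpha> A t (y * r) \<partial>G) = (\<integral>r. (\<Sum>l=0..h. ?c l * E l r) \<partial>G)"
    by (rule integral_cong_AE[OF meas borel_measurable_integrable[OF iS] AE])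
  also have "\<dots> = (\<Sum>l=0..h. ?c l * (\<integral>r. E l r \<partial>G))"
    by (subst Bochner_Integration.integral_sum) (auto intro!: integrable_mult_right iE)
  also have "\<dots> = (\<Sum>l=0..h. ?c l * (\<alpha> * (N l * Gcal G (?m l) (- (y \<cdot>\<^sub>m A))) * t) $$ (0,0))"
    by (intro sum.cong refl) (simp add: intE)
  also have "\<dots> = ?rhs"
  proof -
    let ?Y = "\<lambda>l. N l * Gcal G (?m l) (- (y \<cdot>\<^sub>m A))"
    have Y: "?Y l \<in> carrier_mat n n" for l
      using R(2) by (intro mult_carrier_mat[OF N]) (simp add: Gcal_def)
    have ms: "msum n n (\<lambda>l. ?c l \<cdot>\<^sub>m ?Y l) {0..h} \<in> carrier_mat n n" by (simp add: msum_def)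
    have mi: "msum n n (\<lambda>l. ?c l \<cdot>\<^sub>m ?Y l) {0..h} $$ (i,j) = (\<Sum>l=0..h. ?c l * ?Y l $$ (i,j))"
      if "i < n" "j < n" for i j
      using that carrier_matD[OF Y] by (simp add: msum_def del: index_mult_mat)
    have "(\<alpha> * msum n n (\<lambda>l. ?c l \<cdot>\<^sub>m ?Y l) {0..h} * t) $$ (0,0)
        = (\<Sum>i<n. \<Sum>j<n. \<Sum>l=0..h. ?c l * (\<alpha> $$ (0,i) * ?Y l $$ (i,j) * t $$ (j,0)))"
      unfolding bilinear_index[OF R(1) ms R(3)]
      by (intro sum.cong refl, simp only: lessThan_iff mi)
         (simp add: sum_distrib_left sum_distrib_right mult_ac del: index_mult_mat)
    also have "\<dots> = (\<Sum>i<n. \<Sum>l=0..h. \<Sum>j<n. ?c l * (\<alpha> $$ (0,i) * ?Y l $$ (i,j) * t $$ (j,0)))"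
      by (intro sum.cong refl sum.swap)
    also have "\<dots> = (\<Sum>l=0..h. \<Sum>i<n. \<Sum>j<n. ?c l * (\<alpha> $$ (0,i) * ?Y l $$ (i,j) * t $$ (j,0)))"
      by (rule sum.swap)
    also have "\<dots> = (\<Sum>l=0..h. ?c l * (\<alpha> * ?Y l * t) $$ (0,0))"
      unfolding bilinear_index[OF R(1) Y R(3)] by (simp only: sum_distrib_left)
    finally show ?thesis by (simp only: N_def)
  qed
  finally show "(\<integral>r. inverse r ^ (k + h) * me_tail h \<alpha> A t (y * r) \<partial>G) = ?rhs" .
qed

text \<open>\<psi> may be negative where the density vanishes, so nonnegativity is asked of f \<psi>
  and, almost surely, of \<psi> along (V, B). This suffices for Tonelli; the integrable
  \<open>r\<close> then makes the value finite and turns the identity into one of Bochner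
  integrals.\<close>

lemma expectation_independent_density:
  fixes \<psi> :: "'x \<times> real \<Rightarrow> real"
  assumes P: "prob_space P" and N: "sigma_finite_measure N"
    and V: "distributed P N V (\<lambda>x. ennreal (f x))" and f: "\<And>x. 0 \<le> f x"
    and B [measurable]: "B \<in> borel_measurable P" and Bpos: "AE \<omega> in P. 0 < B \<omega>"
    and indep: "prob_space.indep_set P {V -` A \<inter> space P | A. A \<in> sets N}
        {B -` A \<inter> space P | A. A \<in> sets (borel :: real measure)}"
    and \<psi> [measurable]: "\<psi> \<in> borel_measurable (N \<Otimes>\<^sub>M borel)"
    and nn: "\<And>x b. 0 < b \<Longrightarrow> 0 \<le> f x * \<psi> (x, b)"
    and AEnn: "AE \<omega> in P. 0 \<le> \<psi> (V \<omega>, B \<omega>)"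
    and r: "\<And>b. 0 < b \<Longrightarrow> has_bochner_integral N (\<lambda>x. f x * \<psi> (x, b)) (r b)"
    and int: "integrable (distr P borel B) r"
  shows "(\<integral>\<omega>. \<psi> (V \<omega>, B \<omega>) \<partial>P) = (\<integral>b. r b \<partial>distr P borel B)"
proof -
  interpret P: prob_space P by (rule P)
  have Vm [measurable]: "V \<in> measurable P N" using V by (auto simp: distributed_def)
  have fm [measurable]: "(\<lambda>x. ennreal (f x)) \<in> borel_measurable N" using V by (auto simp: distributed_def)
  have dV: "distr P N V = density N (\<lambda>x. ennreal (f x))" using V by (auto simp: distributed_def)
  let ?G = "distr P borel B"
  interpret dV: prob_space "distr P N V" by (rule P.prob_space_distr) (rule Vm)
  interpret dG: prob_space ?G by (rule P.prob_space_distr) (rule B)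
  interpret pr: pair_prob_space "distr P N V" ?G ..
  \<comment> \<open>Independence is given through preimages, so the joint law is identified with the
    product measure on rectangles.\<close>
  have joint: "distr P N V \<Otimes>\<^sub>M ?G = distr P (N \<Otimes>\<^sub>M borel) (\<lambda>\<omega>. (V \<omega>, B \<omega>))"
  proof (rule pair_measure_eqI)
    fix A C assume "A \<in> sets (distr P N V)" "C \<in> sets ?G"
    then have A: "A \<in> sets N" and C: "C \<in> sets borel" by auto
    have "P.prob ((V -` A \<inter> space P) \<inter> (B -` C \<inter> space P)) = P.prob (V -` A \<inter> space P) * P.prob (B -` C \<inter> space P)"
      by (rule P.indep_setD[OF indep]) (use A C in auto)
    moreover have "(\<lambda>\<omega>. (V \<omega>, B \<omega>)) -` (A \<times> C) \<inter> space P = (V -` A \<inter> space P) \<inter> (B -` C \<inter> space P)"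
      by auto
    ultimately show "emeasure (distr P N V) A * emeasure ?G C
        = emeasure (distr P (N \<Otimes>\<^sub>M borel) (\<lambda>\<omega>. (V \<omega>, B \<omega>))) (A \<times> C)"
      using A C by (simp add: emeasure_distr P.emeasure_eq_measure ennreal_mult)
  qed (auto intro: dV.sigma_finite_measure dG.sigma_finite_measure)
  have pos: "AE b in ?G. 0 < b" using Bpos by (subst AE_distr_iff) auto
  have r0: "0 \<le> r b" if "0 < b" for b
  proof -
    have "0 \<le> (\<integral>x. f x * \<psi> (x, b) \<partial>N)"
      using nn[OF that] by (intro Bochner_Integration.integral_nonneg) auto
    then show ?thesis using r[OF that] by (simp add: has_bochner_integral_iff)
  qed
  have "(\<integral>\<^sup>+\<omega>. ennreal (\<psi> (V \<omega>, B \<omega>)) \<partial>P) = (\<integral>\<^sup>+z. ennreal (\<psi> z) \<partial>(distr P N V \<Otimes>\<^sub>M ?G))"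
    unfolding joint by (subst nn_integral_distr) auto
  also have "\<dots> = (\<integral>\<^sup>+b. \<integral>\<^sup>+x. ennreal (\<psi> (x, b)) \<partial>distr P N V \<partial>?G)"
    by (rule pr.nn_integral_snd[symmetric]) measurable
  also have "\<dots> = (\<integral>\<^sup>+b. ennreal (r b) \<partial>?G)"
  proof (rule nn_integral_cong_AE)
    show "AE b in ?G. (\<integral>\<^sup>+x. ennreal (\<psi> (x, b)) \<partial>distr P N V) = ennreal (r b)"
      using pos
    proof eventually_elim
      case (elim b)
      have "(\<integral>\<^sup>+x. ennreal (\<psi> (x, b)) \<partial>distr P N V) = (\<integral>\<^sup>+x. ennreal (f x) * ennreal (\<psi> (x, b)) \<partial>N)"
        unfolding dV by (rule nn_integral_density) measurable
      also have "\<dots> = (\<integral>\<^sup>+x. ennreal (f x * \<psi> (x, b)) \<partial>N)"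
        using f by (simp add: ennreal_mult')
      also have "\<dots> = ennreal (\<integral>x. f x * \<psi> (x, b) \<partial>N)"
        using r[OF elim] nn[OF elim] by (intro nn_integral_eq_integral) (auto simp: has_bochner_integral_iff)
      also have "(\<integral>x. f x * \<psi> (x, b) \<partial>N) = r b"
        using r[OF elim] by (simp add: has_bochner_integral_iff)
      finally show ?case .
    qed
  qed
  also have "\<dots> = ennreal (\<integral>b. r b \<partial>?G)"
    using pos r0 by (intro nn_integral_eq_integral int) auto
  finally have "(\<integral>\<^sup>+\<omega>. ennreal (\<psi> (V \<omega>, B \<omega>)) \<partial>P) = ennreal (\<integral>b. r b \<partial>?G)" .
  moreover have "0 \<le> (\<integral>b. r b \<partial>?G)"
    using pos r0 by (intro integral_nonneg_AE) auto
  ultimately show ?thesis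
    using AEnn by (subst integral_eq_nn_integral) auto
qed

text \<open>Represents the density of E[X_j^k / k!; S in ds] for one word, with coordinate j moved
  to the front.\<close>

definition size_biased_triple :: "(nat \<Rightarrow> real mat) \<Rightarrow> (nat \<Rightarrow> real mat) \<Rightarrow> (nat \<Rightarrow> real mat) \<Rightarrow>
    nat \<Rightarrow> nat list \<Rightarrow> nat \<Rightarrow> real mat \<times> real mat \<times> real mat" where
  "size_biased_triple \<alpha> T t k is j = (let i = is ! (j - 1) in
     conv_step (alpha_blk (\<alpha> i) k, blockT (T i) k 0, t_blk (t i) k) (conv_triple \<alpha> T t (drop_idx is j)))"

text \<open>The scalar following the weight in the theorem, apart from the factor k!; with k = 0 it
  covers the first formula too.\<close>

definition tail_form :: "nat \<Rightarrow> nat \<Rightarrow> real \<Rightarrow> real measure \<Rightarrow> real mat \<times> real mat \<times> real mat \<Rightarrow> real" where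
  "tail_form k h y G = (\<lambda>(\<alpha>, A, \<tau>). (\<alpha> * msum (dim_row A) (dim_row A)
     (\<lambda>l. (fact h / fact l * y ^ l) \<cdot>\<^sub>m
        (minv (- A) ^\<^sub>m (h - l + 1) * Gcal G (int l - int k - int h) (- (y \<cdot>\<^sub>m A)))) {0..h} * \<tau>) $$ (0,0))"

lemma drop_idx_map:
  assumes "length is = M" "j \<in> {1..M}"
  shows "map (\<lambda>m. is ! (m - 1)) ([1..<j] @ [Suc j..<Suc M]) = drop_idx is j"
proof -
  have "map (\<lambda>m. is ! (m - 1)) [1..<j] = take (j - 1) is"
    using assms by (intro nth_equalityI) auto
  moreover have "map (\<lambda>m. is ! (m - 1)) [Suc j..<Suc M] = drop j is"
    using assms by (intro nth_equalityI) (auto simp del: upt_Suc)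
  ultimately show ?thesis by (simp add: drop_idx_def)
qed

text \<open>For k = 0 the blocked triple is the original one, and position 1 is already in front, so
  nothing is reordered.\<close>

lemma size_biased_triple_0:
  assumes len: "2 \<le> length is" and rep: "\<And>l. l \<in> set is \<Longrightarrow> me_rep (n l) (\<alpha> l) (T l) (t l)"
  shows "size_biased_triple \<alpha> T t 0 is 1 = conv_triple \<alpha> T t is"
proof -
  obtain k k' ks where is_eq: "is = k # k' # ks"
    using len by (cases "is"; cases "tl is") auto
  have k: "me_rep (n k) (\<alpha> k) (T k) (t k)" using rep is_eq by simp
  have "\<exists>q. me_rep q (ct_alpha \<alpha> T t (k' # ks)) (ct_T \<alpha> T t (k' # ks)) (ct_t \<alpha> T t (k' # ks))"
    using rep is_eq by (intro me_rep_conv_triple[where n = n]) auto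
  then obtain q where q: "me_rep q (ct_alpha \<alpha> T t (k' # ks)) (ct_T \<alpha> T t (k' # ks)) (ct_t \<alpha> T t (k' # ks))" ..
  have "drop_idx is 1 = k' # ks" "is ! (1 - 1) = k" by (auto simp: drop_idx_def is_eq)
  then show ?thesis
    using conv_triple_Cons[where a = \<alpha> and T = T and t = t, OF k q]
      alpha_blk_0[OF me_repD(1)[OF k]] blockT_0[OF me_repD(2)[OF k]] t_blk_0[OF me_repD(3)[OF k]]
    by (simp only: size_biased_triple_def Let_def is_eq)
qed

text \<open>The contribution of one word for a fixed value b of the scaling variable. All factors
  are nonnegative here whatever the sign of the weight, so the value is found by nonnegative
  integration and its finiteness yields the Bochner statement.\<close>

lemma word_moment:
  fixes M :: nat and \<alpha> T t :: "nat \<Rightarrow> real mat" and y :: real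
  assumes M: "2 \<le> M" and j: "j \<in> {1..M}" and len: "length is = M"
    and rep: "\<And>l. l \<in> set is \<Longrightarrow> me_rep (n l) (\<alpha> l) (T l) (t l)"
    and y: "0 \<le> y" and tr: "size_biased_triple \<alpha> T t k is j = (a, A, \<tau>)"
  defines "F \<equiv> \<lambda>x. if \<forall>i\<in>{1..M}. 0 \<le> x i
      then \<Prod>i=1..M. me_fun (\<alpha> (is!(i-1))) (T (is!(i-1))) (t (is!(i-1))) (x i) else 0"
  shows "\<exists>q. me_rep q a A \<tau>"
    and "0 < b \<Longrightarrow> has_bochner_integral (PiM {1..M} (\<lambda>_. lborel))
      (\<lambda>x. F x * ((x j / b) ^ k * (\<Sum>i=1..M. x i / b) ^ h * indicator {y<..} (\<Sum>i=1..M. x i / b)))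
      (fact k * (inverse b ^ (k + h) * me_tail h a A \<tau> (y * b)))"
proof -
  let ?k = "\<lambda>m. is ! (m - 1)"
  let ?f = "\<lambda>m. me_fun (\<alpha> (?k m)) (T (?k m)) (t (?k m))" and ?d = "\<lambda>m. me_dens (\<alpha> (?k m)) (T (?k m)) (t (?k m))"
  define ms where "ms = [1..<j] @ [Suc j..<Suc M]"
  have ms: "distinct ms" "set ms = {1..M} - {j}" "map ?k ms = drop_idx is j"
    using drop_idx_map[OF len j] j by (auto simp: ms_def simp del: upt_Suc)
  have ins: "insert j (set ms) = {1..M}" unfolding ms(2) by (rule insert_Diff[OF j])
  have "card (set ms) = M - 1" unfolding ms(2) using j by simp
  \<comment> \<open>Here M \<ge> 2 enters: without remaining coordinates their sum would be a point
    mass at 0, which has no density.\<close>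
  then have ne: "ms \<noteq> []" using M by auto
  have k_rep: "me_rep (n (?k m)) (\<alpha> (?k m)) (T (?k m)) (t (?k m))" if "m \<in> {1..M}" for m
    using that len by (intro rep nth_mem) auto
  have "\<exists>q. me_rep q (ct_alpha \<alpha> T t (drop_idx is j)) (ct_T \<alpha> T t (drop_idx is j)) (ct_t \<alpha> T t (drop_idx is j))"
  proof (rule me_rep_conv_triple[where n = n])
    show "drop_idx is j \<noteq> []" using ne ms(3) by auto
    show "me_rep (n l) (\<alpha> l) (T l) (t l)" if "l \<in> set (drop_idx is j)" for l
      using that by (intro rep) (auto simp: drop_idx_def dest: in_set_takeD in_set_dropD)
  qed
  then obtain q where q: "me_rep q (ct_alpha \<alpha> T t (drop_idx is j)) (ct_T \<alpha> T t (drop_idx is j)) (ct_t \<alpha> T t (drop_idx is j))" ..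
  let ?ba = "alpha_blk (\<alpha> (?k j)) k" and ?bT = "blockT (T (?k j)) k 0" and ?bt = "t_blk (t (?k j)) k"
  note blk = me_rep_blockT[OF k_rep[OF j], of k]
  have cs: "conv_step (?ba, ?bT, ?bt) (ct_alpha \<alpha> T t (drop_idx is j), ct_T \<alpha> T t (drop_idx is j), ct_t \<alpha> T t (drop_idx is j))
      = (a, A, \<tau>)"
    using tr by (simp add: size_biased_triple_def Let_def)
  note rA = me_rep_conv_step[OF blk q cs]
  then show "\<exists>q. me_rep q a A \<tau>" ..
  assume b: "0 < b"
  let ?N = "PiM {1..M} (\<lambda>_. lborel :: real measure)"
  define \<psi> where "\<psi> = (\<lambda>x. (x j / b) ^ k * (\<Sum>i=1..M. x i / b) ^ h * indicator {y<..} (\<Sum>i=1..M. x i / b) :: real)"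
  define \<phi> where "\<phi> = (\<lambda>s. ennreal (s ^ h * indicator {y * b<..} s))"
  have \<phi>: "\<phi> \<in> borel_measurable borel" unfolding \<phi>_def by measurable
  let ?c = "inverse b ^ (k + h) * fact k"
  have c: "0 \<le> ?c" using b by simp
  have F0: "0 \<le> F x * \<psi> x" for x
  proof (cases "\<forall>i\<in>{1..M}. 0 \<le> x i")
    case True
    then have "0 \<le> F x" using me_repD(5)[OF k_rep] by (auto simp: F_def intro!: prod_nonneg)
    moreover have "0 \<le> \<psi> x" using True j b by (auto simp: \<psi>_def intro!: mult_nonneg_nonneg zero_le_power sum_nonneg)
    ultimately show ?thesis by simp
  qed (auto simp: F_def)
  \<comment> \<open>On the orthant, b survives only in the constant and in the threshold y b, and
    x_j^k is absorbed into the blocked density. Off the orthant some coordinate is negative and both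
    sides are 0.\<close>
  have pointwise: "ennreal (F x * \<psi> x) = ennreal ?c * (\<phi> (\<Sum>i\<in>insert j (set ms). x i) *
      (me_dens ?ba ?bT ?bt (x j) * (\<Prod>i\<in>set ms. ?d i (x i))))" for x
  proof (cases "\<forall>i\<in>{1..M}. 0 \<le> x i")
    case True
    let ?S = "\<Sum>i=1..M. x i"
    have S: "(\<Sum>i=1..M. x i / b) = ?S / b" by (simp add: sum_divide_distrib)
    have S0: "0 \<le> ?S" using True by (intro sum_nonneg) auto
    have f0: "0 \<le> ?f i (x i)" if "i \<in> {1..M}" for i using True that me_repD(5)[OF k_rep] by auto
    have e: "(\<Prod>i\<in>set ms. ?d i (x i)) = ennreal (\<Prod>i\<in>set ms. ?f i (x i))"
      using True f0 ms(2) by (subst prod_ennreal[symmetric]) (auto simp: me_dens_def intro!: prod.cong)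
    have d: "me_dens ?ba ?bT ?bt (x j) = ennreal (x j ^ k / fact k * ?f j (x j))"
      using True j me_fun_blockT[OF me_repD(1-3)[OF k_rep[OF j]], of k] by (auto simp: me_dens_def)
    have d0: "0 \<le> x j ^ k / fact k * ?f j (x j)" using True j f0[OF j] by auto
    have F: "F x = ?f j (x j) * (\<Prod>i\<in>set ms. ?f i (x i))"
      unfolding F_def using True j by (simp add: ms(2) prod.remove)
    have ind: "indicator {y<..} (?S / b) = (indicator {y * b<..} ?S :: real)"
      using b by (auto simp: pos_less_divide_eq split: split_indicator)
    have eq: "F x * \<psi> x = ?c * (?S ^ h * indicator {y * b<..} ?S *
        (x j ^ k / fact k * ?f j (x j) * (\<Prod>i\<in>set ms. ?f i (x i))))"
      unfolding F \<psi>_def S ind by (simp add: power_divide power_add field_simps power_inverse)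
    show ?thesis
      unfolding eq ins e d ennreal_mult'[OF c] ennreal_mult'[OF mult_nonneg_nonneg[OF zero_le_power[OF S0] indicator_pos_le]]
        ennreal_mult'[OF d0] \<phi>_def ..
  next
    case False
    then obtain i where i: "i \<in> {1..M}" "x i < 0" by force
    have zero: "me_dens \<beta> U u (x i) = 0" for \<beta> U u using i(2) by (simp add: me_dens_def)
    have pz: "me_dens ?ba ?bT ?bt (x j) * (\<Prod>i\<in>set ms. ?d i (x i)) = 0"
    proof (cases "i = j")
      case True
      then show ?thesis using zero by simp
    next
      case False
      then have "i \<in> set ms" using i(1) ms(2) by simp
      then have "(\<Prod>i\<in>set ms. ?d i (x i)) = 0" using zero by (intro prod_zero) blast+
      then show ?thesis by simp
    qed
    have "F x = 0" unfolding F_def by (rule if_not_P[OF False])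
    then show ?thesis by (simp only: pz mult_zero_left mult_zero_right ennreal_0)
  qed
  have fm: "?f i \<in> borel_measurable borel" if "i \<in> {1..M}" for i by (rule me_fun_measurable[OF k_rep[OF that]])
  have dm: "?d i \<in> borel_measurable borel" if "i \<in> {1..M}" for i by (rule me_dens_measurable[OF k_rep[OF that]])
  have xm: "(\<lambda>x. x i) \<in> borel_measurable ?N" if "i \<in> {1..M}" for i
    using measurable_component_singleton[OF that, of "\<lambda>_. lborel :: real measure"] by simp
  have Fm: "F \<in> borel_measurable ?N"
    unfolding F_def
  proof (rule measurable_If)
    show "(\<lambda>x. \<Prod>i=1..M. ?f i (x i)) \<in> borel_measurable ?N"
      by (intro borel_measurable_prod measurable_compose[OF xm fm]) auto
    show "{x \<in> space ?N. \<forall>i\<in>{1..M}. 0 \<le> x i} \<in> sets ?N"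
      by (intro sets.sets_Collect_finite_All borel_measurable_le borel_measurable_const xm) auto
  qed simp
  have \<psi>m: "\<psi> \<in> borel_measurable ?N"
  proof -
    have "(\<lambda>x. \<Sum>i=1..M. x i / b) \<in> borel_measurable ?N"
      by (intro borel_measurable_sum borel_measurable_divide xm borel_measurable_const) auto
    moreover have "(\<lambda>x. x j / b) \<in> borel_measurable ?N"
      by (intro borel_measurable_divide xm borel_measurable_const j)
    ultimately show ?thesis unfolding \<psi>_def by measurable
  qed
  have meas: "(\<lambda>x. \<phi> (\<Sum>i\<in>insert j (set ms). x i) *
      (me_dens ?ba ?bT ?bt (x j) * (\<Prod>i\<in>set ms. ?d i (x i)))) \<in> borel_measurable ?N"
    using ms(2) ins
    by (intro borel_measurable_times_ennreal measurable_compose[OF _ \<phi>] borel_measurable_sum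
        measurable_compose[OF xm me_dens_measurable[OF blk]] borel_measurable_prod_ennreal
        measurable_compose[OF xm dm] j xm) auto
  have "(\<integral>\<^sup>+x. ennreal (F x * \<psi> x) \<partial>?N)
      = ennreal ?c * (\<integral>\<^sup>+x. \<phi> (\<Sum>i\<in>insert j (set ms). x i) *
          (me_dens ?ba ?bT ?bt (x j) * (\<Prod>i\<in>set ms. ?d i (x i))) \<partial>?N)"
    unfolding pointwise by (rule nn_integral_cmult[OF meas])
  also have "(\<integral>\<^sup>+x. \<phi> (\<Sum>i\<in>insert j (set ms). x i) *
          (me_dens ?ba ?bT ?bt (x j) * (\<Prod>i\<in>set ms. ?d i (x i))) \<partial>?N)
      = (\<integral>\<^sup>+u. \<integral>\<^sup>+v. \<phi> (u + v) * me_dens ?ba ?bT ?bt u *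
          me_dens (ct_alpha \<alpha> T t (drop_idx is j)) (ct_T \<alpha> T t (drop_idx is j)) (ct_t \<alpha> T t (drop_idx is j)) v
          \<partial>lborel \<partial>lborel)"
    unfolding ins[symmetric]
  proof (rule nn_integral_PiM_insert_sum)
    show "(\<integral>\<^sup>+x. \<psi>' (\<Sum>i\<in>set ms. x i) * (\<Prod>i\<in>set ms. ?d i (x i)) \<partial>PiM (set ms) (\<lambda>_. lborel))
        = (\<integral>\<^sup>+v. \<psi>' v * me_dens (ct_alpha \<alpha> T t (drop_idx is j)) (ct_T \<alpha> T t (drop_idx is j)) (ct_t \<alpha> T t (drop_idx is j)) v \<partial>lborel)"
      if "\<psi>' \<in> borel_measurable borel" for \<psi>'
      unfolding ms(3)[symmetric]
      by (rule nn_integral_PiM_conv_triple[where n = n, OF ne ms(1) _ that]) (use k_rep ms(2) in auto)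
    show "?d i \<in> borel_measurable borel" if "i \<in> set ms" for i using that ms(2) dm by auto
  qed (use me_dens_measurable[OF blk] \<phi> ms(2) in auto)
  also have "\<dots> = (\<integral>\<^sup>+s. \<phi> s * me_dens a A \<tau> s \<partial>lborel)"
    by (rule nn_integral_conv_step[OF blk q cs \<phi>])
  also have "\<dots> = ennreal (me_tail h a A \<tau> (y * b))"
    unfolding \<phi>_def using y b by (intro nn_integral_me_tail[OF rA]) auto
  also have "ennreal ?c * ennreal (me_tail h a A \<tau> (y * b))
      = ennreal (fact k * (inverse b ^ (k + h) * me_tail h a A \<tau> (y * b)))"
    using c by (subst ennreal_mult'[symmetric]) (auto simp: mult_ac)
  finally have "(\<integral>\<^sup>+x. ennreal (F x * \<psi> x) \<partial>?N)
      = ennreal (fact k * (inverse b ^ (k + h) * me_tail h a A \<tau> (y * b)))" .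
  then show "has_bochner_integral ?N
      (\<lambda>x. F x * ((x j / b) ^ k * (\<Sum>i=1..M. x i / b) ^ h * indicator {y<..} (\<Sum>i=1..M. x i / b)))
      (fact k * (inverse b ^ (k + h) * me_tail h a A \<tau> (y * b)))"
    unfolding \<psi>_def[symmetric]
    using F0 Fm \<psi>m nn_integral_me_tail(2)[OF rA, of "y * b" h] y b
    by (intro has_bochner_integral_nn_integral) (auto simp: \<psi>_def)
qed

section \<open>Assembling the mixture\<close>

theorem theorem14:
  fixes L M :: nat
    and \<alpha> T t :: "nat \<Rightarrow> real mat"
    and p :: "nat list \<Rightarrow> real"
    and P :: "'w measure"
    and X :: "nat \<Rightarrow> 'w \<Rightarrow> real"
    and B :: "'w \<Rightarrow> real"
    and j :: nat
  defines "S \<equiv> {is. length is = M \<and> set is \<subseteq> {1..L}}"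
  defines "Xd \<equiv> (\<lambda>i \<omega>. X i \<omega> / B \<omega>)"
  defines "Sd \<equiv> (\<lambda>\<omega>. \<Sum>i=1..M. X i \<omega> / B \<omega>)"
  defines "G \<equiv> distr P borel B"
  assumes L: "L \<ge> 1" and M: "M \<ge> 2"
    and ME: "\<And>l. l \<in> {1..L} \<Longrightarrow> me_density (\<alpha> l) (T l) (t l)"
    and psum: "(\<Sum>is\<in>S. p is) = 1"
    and fnonneg: "\<And>x. (\<forall>i\<in>{1..M}. 0 \<le> x i) \<Longrightarrow>
        0 \<le> (\<Sum>is\<in>S. p is * (\<Prod>i=1..M. me_fun (\<alpha> (is!(i-1))) (T (is!(i-1))) (t (is!(i-1))) (x i)))"
    and P: "prob_space P"
    and Xdist: "distributed P (PiM {1..M} (\<lambda>_. lborel)) (\<lambda>\<omega>. \<lambda>i\<in>{1..M}. X i \<omega>)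
        (\<lambda>x. ennreal (if \<forall>i\<in>{1..M}. 0 \<le> x i
           then \<Sum>is\<in>S. p is * (\<Prod>i=1..M. me_fun (\<alpha> (is!(i-1))) (T (is!(i-1))) (t (is!(i-1))) (x i))
           else 0))"
    and Bmeas: "B \<in> borel_measurable P"
    and Bpos: "AE \<omega> in P. B \<omega> > 0"
    and indep: "prob_space.indep_set P
        {(\<lambda>\<omega>. \<lambda>i\<in>{1..M}. X i \<omega>) -` A \<inter> space P | A. A \<in> sets (PiM {1..M} (\<lambda>_. lborel))}
        {B -` A \<inter> space P | A. A \<in> sets (borel :: real measure)}"
    and j: "j \<in> {1..M}"
  shows
   "(\<forall>(h::nat) (y::real). 0 \<le> y \<longrightarrow> integrable P (\<lambda>\<omega>. inverse (B \<omega>) ^ h) \<longrightarrow>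
      (\<integral>\<omega>. Sd \<omega> ^ h * indicator {y<..} (Sd \<omega>) \<partial>P) =
      (\<Sum>is\<in>S. p is *
         (ct_alpha \<alpha> T t is *
          msum (dim_row (ct_T \<alpha> T t is)) (dim_row (ct_T \<alpha> T t is))
            (\<lambda>l. (fact h / fact l * y ^ l) \<cdot>\<^sub>m
                 (minv (- ct_T \<alpha> T t is) ^\<^sub>m (h - l + 1) *
                  Gcal G (int l - int h) (- (y \<cdot>\<^sub>m ct_T \<alpha> T t is)))) {0..h}
          * ct_t \<alpha> T t is) $$ (0,0))) \<and>
    (\<forall>(k::nat) (h::nat) (y::real). 1 \<le> k \<longrightarrow> 0 \<le> y \<longrightarrow>
      integrable P (\<lambda>\<omega>. inverse (B \<omega>) ^ (k + h)) \<longrightarrow>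
      (\<integral>\<omega>. Xd j \<omega> ^ k * Sd \<omega> ^ h * indicator {y<..} (Sd \<omega>) \<partial>P) =
      (\<Sum>is\<in>S.
         (let ij = is ! (j - 1);
              a' = ct_alpha \<alpha> T t (drop_idx is j);
              T' = ct_T \<alpha> T t (drop_idx is j);
              t' = ct_t \<alpha> T t (drop_idx is j);
              A = four_block_mat (blockT (T ij) k 0) (t_blk (t ij) k * a')
                    (0\<^sub>m (dim_row T') ((k+1) * dim_row (T ij))) T';
              n = dim_row A
          in p is * fact k *
             (row_cat (alpha_blk (\<alpha> ij) k) (0\<^sub>m 1 (dim_row T')) *
              msum n n
               (\<lambda>l. (fact h / fact l * y ^ l) \<cdot>\<^sub>m
                    (minv (- A) ^\<^sub>m (h - l + 1) *
                     Gcal G (int l - int k - int h) (- (y \<cdot>\<^sub>m A)))) {0..h}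
              * col_cat (0\<^sub>m ((k+1) * dim_row (T ij)) 1) t') $$ (0,0))))"
proof -
  interpret prob_space P by (rule P)
  let ?N = "PiM {1..M} (\<lambda>_. lborel :: real measure)"
  let ?n = "\<lambda>l. dim_row (T l)"
  \<comment> \<open>The facts \<open>R\<close> below share the assumption 0 < b, although two of
    them do not mention b; 1 is the value used to discharge it.\<close>
  have one: "0 < (1::real)" by simp
  define V where "V = (\<lambda>\<omega>. \<lambda>i\<in>{1..M}. X i \<omega>)"
  define F where "F = (\<lambda>is x. if \<forall>i\<in>{1..M}. 0 \<le> x i
      then \<Prod>i=1..M. me_fun (\<alpha> (is!(i-1))) (T (is!(i-1))) (t (is!(i-1))) (x i) else 0)"
  define f where "f = (\<lambda>x. \<Sum>is\<in>S. p is * F is x)"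
  have f_eq: "f x = (if \<forall>i\<in>{1..M}. 0 \<le> x i
      then \<Sum>is\<in>S. p is * (\<Prod>i=1..M. me_fun (\<alpha> (is!(i-1))) (T (is!(i-1))) (t (is!(i-1))) (x i)) else 0)" for x
  proof (cases "\<forall>i\<in>{1..M}. 0 \<le> x i")
    case True
    show ?thesis unfolding f_def F_def if_P[OF True] ..
  next
    case False
    show ?thesis unfolding f_def F_def if_not_P[OF False] by simp
  qed
  have f0: "0 \<le> f x" for x
  proof (cases "\<forall>i\<in>{1..M}. 0 \<le> x i")
    case True
    from fnonneg[OF True] show ?thesis unfolding f_eq if_P[OF True] .
  next
    case False
    then show ?thesis unfolding f_eq if_not_P[OF False] by simp
  qed
  have Vdist: "distributed P ?N V (\<lambda>x. ennreal (f x))"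
    unfolding V_def f_eq by (rule Xdist)
  have xm: "(\<lambda>x. x i) \<in> borel_measurable ?N" if "i \<in> {1..M}" for i
    using measurable_component_singleton[OF that, of "\<lambda>_. lborel :: real measure"] by simp
  \<comment> \<open>The density vanishes off the orthant, so the vector is almost surely
    nonnegative; this supplies the almost sure nonnegativity of \<psi>.\<close>
  have "AE x in ?N. 0 < ennreal (f x) \<longrightarrow> (\<forall>i\<in>{1..M}. 0 \<le> x i)"
    by (rule AE_I2) (simp only: f_eq, simp)
  moreover have "{x \<in> space ?N. \<forall>i\<in>{1..M}. 0 \<le> x i} \<in> sets ?N"
    by (intro sets.sets_Collect_finite_All borel_measurable_le borel_measurable_const xm) auto
  ultimately have Xpos: "AE \<omega> in P. \<forall>i\<in>{1..M}. 0 \<le> V \<omega> i"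
    using distributed_AE2[OF Vdist, of "\<lambda>x. \<forall>i\<in>{1..M}. 0 \<le> x i"] by (simp add: pred_def)
  have rep: "me_rep (?n l) (\<alpha> l) (T l) (t l)" if "is \<in> S" "l \<in> set is" for "is" l
    using that by (intro me_density_me_rep ME) (auto simp: S_def)
  have Glaw: "prob_space G" "sets G = sets borel" "AE r in G. 0 < r"
    using Bpos Bmeas unfolding G_def by (auto intro: prob_space_distr simp: AE_distr_iff)
  \<comment> \<open>Stated for every k, including 0, and for every coordinate, because the first
    formula uses it at coordinate 1.\<close>
  have main: "(\<integral>\<omega>. Xd j \<omega> ^ k * Sd \<omega> ^ h * indicator {y<..} (Sd \<omega>) \<partial>P)
      = (\<Sum>is\<in>S. p is * fact k * tail_form k h y G (size_biased_triple \<alpha> T t k is j))"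
    if j: "j \<in> {1..M}" and y: "0 \<le> y" and int: "integrable P (\<lambda>\<omega>. inverse (B \<omega>) ^ (k + h))" for j k h y
  proof -
    define \<psi> where "\<psi> = (\<lambda>(x, b). (x j / b) ^ k * (\<Sum>i=1..M. x i / b) ^ h *
        indicator {y<..} (\<Sum>i=1..M. x i / b) :: real)"
    define R where "R = (\<lambda>is b. fact k * (inverse b ^ (k + h) *
        (case size_biased_triple \<alpha> T t k is j of (a, A, \<tau>) \<Rightarrow> me_tail h a A \<tau> (y * b))))"
    have intG: "integrable G (\<lambda>r. inverse r ^ (k + h))"
      unfolding G_def using int Bmeas by (subst integrable_distr_eq) auto
    have xbm: "(\<lambda>z. fst z i / snd z) \<in> borel_measurable (?N \<Otimes>\<^sub>M borel)" if "i \<in> {1..M}" for i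
      by (intro borel_measurable_divide measurable_compose[OF measurable_fst xm[OF that]] measurable_snd)
    have \<psi>m: "\<psi> \<in> borel_measurable (?N \<Otimes>\<^sub>M borel)"
    proof -
      have "(\<lambda>z. \<Sum>i=1..M. fst z i / snd z) \<in> borel_measurable (?N \<Otimes>\<^sub>M borel)"
        by (intro borel_measurable_sum xbm)
      then show ?thesis using xbm[OF j] unfolding \<psi>_def case_prod_beta by measurable
    qed
    have \<psi>0: "0 \<le> \<psi> (x, b)" if "\<forall>i\<in>{1..M}. 0 \<le> x i" "0 < b" for x b
      using that j unfolding \<psi>_def prod.case
      by (intro mult_nonneg_nonneg zero_le_power sum_nonneg divide_nonneg_pos indicator_pos_le) auto
    have R: "has_bochner_integral ?N (\<lambda>x. F is x * \<psi> (x, b)) (R is b)"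
        "integrable G (R is)" "(\<integral>b. R is b \<partial>G) = fact k * tail_form k h y G (size_biased_triple \<alpha> T t k is j)"
      if "is": "is \<in> S" and b: "0 < b" for "is" and b :: real
    proof -
      obtain a A \<tau> where tr: "size_biased_triple \<alpha> T t k is j = (a, A, \<tau>)"
        by (cases "size_biased_triple \<alpha> T t k is j")
      have len: "length is = M" using "is" by (simp add: S_def)
      note wm = word_moment[where n = ?n and \<alpha> = \<alpha> and T = T and t = t, OF M j len rep[OF "is"] y tr]
      obtain q where q: "me_rep q a A \<tau>" using wm(1) by blast
      have dimA: "dim_row A = q" using me_repD(2)[OF q] by simp
      have R_eq: "R is = (\<lambda>b. fact k * (inverse b ^ (k + h) * me_tail h a A \<tau> (y * b)))"
        by (simp add: R_def tr)
      show "has_bochner_integral ?N (\<lambda>x. F is x * \<psi> (x, b)) (R is b)"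
        unfolding R_eq F_def \<psi>_def prod.case by (rule wm(2)[OF _ b]) assumption
      note G = Gcal_me_tail[OF q y Glaw intG]
      show "integrable G (R is)" unfolding R_eq by (intro integrable_mult_right G(1))
      show "(\<integral>b. R is b \<partial>G) = fact k * tail_form k h y G (size_biased_triple \<alpha> T t k is j)"
        unfolding R_eq tr tail_form_def prod.case dimA by (simp only: integral_mult_right_zero G(2))
    qed
    have "(\<integral>\<omega>. Xd j \<omega> ^ k * Sd \<omega> ^ h * indicator {y<..} (Sd \<omega>) \<partial>P) = (\<integral>\<omega>. \<psi> (V \<omega>, B \<omega>) \<partial>P)"
    proof -
      have "(\<Sum>i=1..M. V \<omega> i / B \<omega>) = Sd \<omega>" for \<omega>
        unfolding Sd_def V_def by (intro sum.cong) auto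
      moreover have "V \<omega> j / B \<omega> = Xd j \<omega>" for \<omega> using j by (simp add: V_def Xd_def)
      ultimately show ?thesis by (simp add: \<psi>_def)
    qed
    also have "\<dots> = (\<integral>b. (\<Sum>is\<in>S. p is * R is b) \<partial>distr P borel B)"
    proof (rule expectation_independent_density[OF P _ Vdist f0 Bmeas Bpos _ \<psi>m])
      show "sigma_finite_measure ?N"
        by (intro product_sigma_finite.sigma_finite product_sigma_finite.intro sigma_finite_lborel) simp
      show "indep_set {V -` A \<inter> space P |A. A \<in> sets ?N} {B -` A \<inter> space P |A. A \<in> sets borel}"
        unfolding V_def by (rule indep)
      show "0 \<le> f x * \<psi> (x, b)" if "0 < b" for x b
      proof (cases "\<forall>i\<in>{1..M}. 0 \<le> x i")
        case True
        then show ?thesis using f0 \<psi>0[OF True that] by simp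
      next
        case False
        have "f x = 0" unfolding f_eq by (rule if_not_P[OF False])
        then show ?thesis by simp
      qed
      show "AE \<omega> in P. 0 \<le> \<psi> (V \<omega>, B \<omega>)"
        using Xpos Bpos by eventually_elim (rule \<psi>0)
      show "has_bochner_integral ?N (\<lambda>x. f x * \<psi> (x, b)) (\<Sum>is\<in>S. p is * R is b)" if "0 < b" for b
        unfolding f_def sum_distrib_right mult.assoc
        \<comment> \<open>The only effect of the signs of the weights is here and in the two
          linearity steps that follow: sums of integrable functions need no sign.\<close>
        by (intro has_bochner_integral_sum has_bochner_integral_mult_right R(1) that)
      show "integrable (distr P borel B) (\<lambda>b. \<Sum>is\<in>S. p is * R is b)"
        unfolding G_def[symmetric]
        by (intro Bochner_Integration.integrable_sum integrable_mult_right R(2)[OF _ one])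
    qed
    also have "\<dots> = (\<Sum>is\<in>S. \<integral>b. p is * R is b \<partial>G)"
      unfolding G_def[symmetric]
      by (intro Bochner_Integration.integral_sum integrable_mult_right R(2)[OF _ one])
    also have "\<dots> = (\<Sum>is\<in>S. p is * fact k * tail_form k h y G (size_biased_triple \<alpha> T t k is j))"
      by (intro sum.cong refl) (simp only: integral_mult_right_zero R(3)[OF _ one] mult.assoc)
    finally show ?thesis .
  qed
  show ?thesis
  proof (intro conjI allI impI)
    fix h :: nat and y :: real
    assume y: "0 \<le> y" and int: "integrable P (\<lambda>\<omega>. inverse (B \<omega>) ^ h)"
    have "(\<integral>\<omega>. Sd \<omega> ^ h * indicator {y<..} (Sd \<omega>) \<partial>P)
        = (\<Sum>is\<in>S. p is * fact 0 * tail_form 0 h y G (size_biased_triple \<alpha> T t 0 is 1))"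
      using main[of 1 y 0 h] M y int by simp
    also have "\<dots> = (\<Sum>is\<in>S. p is * tail_form 0 h y G (conv_triple \<alpha> T t is))"
    proof (intro sum.cong refl)
      fix "is" assume "is": "is \<in> S"
      have "2 \<le> length is" using M "is" by (simp add: S_def)
      from size_biased_triple_0[where n = ?n and \<alpha> = \<alpha> and T = T and t = t, OF this rep[OF "is"]]
      show "p is * fact 0 * tail_form 0 h y G (size_biased_triple \<alpha> T t 0 is 1)
          = p is * tail_form 0 h y G (conv_triple \<alpha> T t is)" by simp
    qed
    finally show "(\<integral>\<omega>. Sd \<omega> ^ h * indicator {y<..} (Sd \<omega>) \<partial>P) =
      (\<Sum>is\<in>S. p is *
         (ct_alpha \<alpha> T t is *
          msum (dim_row (ct_T \<alpha> T t is)) (dim_row (ct_T \<alpha> T t is))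
            (\<lambda>l. (fact h / fact l * y ^ l) \<cdot>\<^sub>m
                 (minv (- ct_T \<alpha> T t is) ^\<^sub>m (h - l + 1) *
                  Gcal G (int l - int h) (- (y \<cdot>\<^sub>m ct_T \<alpha> T t is)))) {0..h}
          * ct_t \<alpha> T t is) $$ (0,0))"
      by (simp only: tail_form_def case_prod_beta of_nat_0 diff_zero)
  next
    fix k h :: nat and y :: real
    assume y: "0 \<le> y" and int: "integrable P (\<lambda>\<omega>. inverse (B \<omega>) ^ (k + h))"
    \<comment> \<open>The zero blocks of the theorem are sized by the explicit product, those of
      \<open>conv_step\<close> by the row count of the blocked matrix.\<close>
    have dim: "dim_row (blockT U k 0) = (k + 1) * dim_row U" for U by (simp add: blockT_def Let_def)
    show "(\<integral>\<omega>. Xd j \<omega> ^ k * Sd \<omega> ^ h * indicator {y<..} (Sd \<omega>) \<partial>P) =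
      (\<Sum>is\<in>S.
         (let ij = is ! (j - 1);
              a' = ct_alpha \<alpha> T t (drop_idx is j);
              T' = ct_T \<alpha> T t (drop_idx is j);
              t' = ct_t \<alpha> T t (drop_idx is j);
              A = four_block_mat (blockT (T ij) k 0) (t_blk (t ij) k * a')
                    (0\<^sub>m (dim_row T') ((k+1) * dim_row (T ij))) T';
              n = dim_row A
          in p is * fact k *
             (row_cat (alpha_blk (\<alpha> ij) k) (0\<^sub>m 1 (dim_row T')) *
              msum n n
               (\<lambda>l. (fact h / fact l * y ^ l) \<cdot>\<^sub>m
                    (minv (- A) ^\<^sub>m (h - l + 1) *
                     Gcal G (int l - int k - int h) (- (y \<cdot>\<^sub>m A)))) {0..h}
              * col_cat (0\<^sub>m ((k+1) * dim_row (T ij)) 1) t') $$ (0,0)))"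
      unfolding main[OF j y int]
      by (simp only: tail_form_def size_biased_triple_def conv_step_def case_prod_beta fst_conv snd_conv Let_def dim)
  qed
qed

end
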